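(* Let $\Gamma$ be a finite group and $\mathbb{F}$ a field of characteristic zero. Ring homomorphisms $\mathcal{R}_\Gamma\to\mathbb{F}$ are given by evaluating each $T(c)$, $c\in\Gamma_*$, at an arbitrary element of $\mathbb{F}$, and are hence parametrised by $\mathbb{F}^{\Gamma_*}=\mathbb{F}\Gamma_*$; that is, $\varphi\mapsto(\varphi(T(c)))_{c\in\Gamma_*}$ is a bijection from the set of ring homomorphisms $\mathcal{R}_\Gamma\to\mathbb{F}$ to $\mathbb{F}^{\Gamma_*}$.
   Context: $\Gamma_*$ is the set of conjugacy classes of $\Gamma$, each identified with its class sum. Let $\mathfrak{g}=\mathbb{Q}\Gamma_*=Z(\mathbb{Q}\Gamma)$, an abelian Lie algebra, with canonical map $\iota:\mathfrak{g}\to\mathcal{U}(\mathfrak{g})$ (so $\mathcal{U}(\mathfrak{g})$ is a polynomial algebra), and let $T:\mathfrak{g}[[x_c:c\in\Gamma_*]]\to\mathcal{U}(\mathfrak{g})[[x_c:c\in\Gamma_*]]$ apply $\iota$ coefficientwise; in particular $T(c)=\iota(c)$. Define $B_{\mathbf{N}}\in\mathcal{U}(\mathfrak{g})$ for $\mathbf{N}\in\mathbb{Z}_{\ge0}^{\Gamma_*}$ by $\exp(T(\log(1+\sum_cc\,x_c)))=\sum_{\mathbf{N}}B_{\mathbf{N}}\prod_cx_c^{\mathbf{N}(c)}$, the logarithm being computed with the associative product of $\mathbb{Q}\Gamma_*$. $\mathcal{R}_\Gamma$ is the $\mathbb{Z}$-span of the $B_{\mathbf{N}}$, a commutative subring of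 $\mathcal{U}(\mathfrak{g})$; it contains each $T(c)$ (the coefficient of $x_c$). *)

theory Defs
  imports
    "HOL-Library.Poly_Mapping"
    "HOL-Library.FuncSet"
    "HOL-Algebra.Algebraic_Closure_Type"
begin

section \<open>Rational algebras\<close>

class rat_algebra_1 = ring_1 +
  fixes scaleQ :: "rat \<Rightarrow> 'a \<Rightarrow> 'a" (infixr "*\<^sub>Q" 75)
  assumes scaleQ_add_right: "q *\<^sub>Q (x + y) = q *\<^sub>Q x + q *\<^sub>Q y"
    and scaleQ_add_left: "(p + q) *\<^sub>Q x = p *\<^sub>Q x + q *\<^sub>Q x"
    and scaleQ_scaleQ: "p *\<^sub>Q q *\<^sub>Q x = (p * q) *\<^sub>Q x"
    and scaleQ_one: "1 *\<^sub>Q x = x"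
    and mult_scaleQ_left: "q *\<^sub>Q x * y = q *\<^sub>Q (x * y)"
    and mult_scaleQ_right: "x * q *\<^sub>Q y = q *\<^sub>Q (x * y)"

section \<open>The centre of the rational group algebra\<close>

text \<open>
  The group \<open>\<Gamma>\<close> is a type of class \<^class>\<open>group_add\<close>: it is written additively but is not assumed
  to be commutative.  The type \<open>'g \<Rightarrow>\<^sub>0 rat\<close> with its convolution product is then the rational
  group algebra, and \<open>Poly_Mapping.single g 1\<close> is the group element \<open>g\<close> in it.
\<close>

lemma poly_mapping_single_induct [case_names zero add]:
  fixes p :: "'a \<Rightarrow>\<^sub>0 'b::comm_monoid_add"
  assumes "P 0" and "\<And>p k v. P p \<Longrightarrow> P (Poly_Mapping.single k v + p)"
  shows "P p"
proof (induction p rule: update_induct)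
  case const
  show ?case by (rule assms(1))
next
  case (update f k v)
  have "Poly_Mapping.update k v f = Poly_Mapping.single k v + f"
    using update(1) by (intro poly_mapping_eqI)
      (auto simp: lookup_add lookup_single when_def lookup_update in_keys_iff)
  then show ?case using update assms(2) by simp
qed

lemma single_zero_commute:
  fixes p :: "'a::monoid_add \<Rightarrow>\<^sub>0 'b::comm_semiring_1"
  shows "p * Poly_Mapping.single 0 q = Poly_Mapping.single 0 q * p"
  by (induction p rule: poly_mapping_single_induct)
    (simp_all add: distrib_left distrib_right mult_single mult.commute)

typedef (overloaded) ('g::group_add) group_algebra_center =
  "{z :: 'g \<Rightarrow>\<^sub>0 rat. \<forall>a. z * a = a * z}"
  by (rule exI[of _ 0]) simp

setup_lifting type_definition_group_algebra_center

instantiation group_algebra_center :: (group_add) "{comm_ring_1, rat_algebra_1}"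
begin

lift_definition zero_group_algebra_center :: "'a group_algebra_center" is 0 by simp
lift_definition one_group_algebra_center :: "'a group_algebra_center" is 1 by simp
lift_definition plus_group_algebra_center ::
    "'a group_algebra_center \<Rightarrow> 'a group_algebra_center \<Rightarrow> 'a group_algebra_center" is "(+)"
  by (simp only: distrib_left distrib_right)
lift_definition uminus_group_algebra_center ::
    "'a group_algebra_center \<Rightarrow> 'a group_algebra_center" is uminus
  by (simp only: mult_minus_left mult_minus_right)
lift_definition minus_group_algebra_center ::
    "'a group_algebra_center \<Rightarrow> 'a group_algebra_center \<Rightarrow> 'a group_algebra_center" is "(-)"
  by (simp only: left_diff_distrib right_diff_distrib)
lift_definition times_group_algebra_center ::
    "'a group_algebra_center \<Rightarrow> 'a group_algebra_center \<Rightarrow> 'a group_algebra_center" is "(*)"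
  by (metis mult.assoc)
lift_definition scaleQ_group_algebra_center ::
    "rat \<Rightarrow> 'a group_algebra_center \<Rightarrow> 'a group_algebra_center"
    is "\<lambda>q z. Poly_Mapping.single 0 q * z"
  by (metis mult.assoc single_zero_commute)

instance
proof
  fix a b c :: "'a group_algebra_center" and p q :: rat
  show "a * b * c = a * (b * c)" by transfer (rule mult.assoc)
  show "a * b = b * a" by transfer blast
  show "1 * a = a" by transfer (rule mult_1_left)
  show "a * 1 = a" by transfer (rule mult_1_right)
  show "a + b + c = a + (b + c)" by transfer (rule add.assoc)
  show "a + b = b + a" by transfer (rule add.commute)
  show "0 + a = a" by transfer (rule add_0)
  show "- a + a = 0" by transfer (rule left_minus)
  show "a - b = a + - b" by transfer (rule diff_conv_add_uminus)
  show "(a + b) * c = a * c + b * c" by transfer (rule distrib_right)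
  show "a * (b + c) = a * b + a * c" by transfer (rule distrib_left)
  show "(0::'a group_algebra_center) \<noteq> 1" by transfer (rule zero_neq_one)
  show "q *\<^sub>Q (a + b) = q *\<^sub>Q a + q *\<^sub>Q b" by transfer (rule distrib_left)
  show "(p + q) *\<^sub>Q a = p *\<^sub>Q a + q *\<^sub>Q a"
    by transfer (simp only: distrib_right single_add)
  show "p *\<^sub>Q q *\<^sub>Q a = (p * q) *\<^sub>Q a"
    by transfer (simp only: mult_single add_0 flip: mult.assoc)
  show "1 *\<^sub>Q a = a" by transfer (simp only: single_one mult_1_left)
  show "q *\<^sub>Q a * b = q *\<^sub>Q (a * b)" by transfer (rule mult.assoc)
  show "a * q *\<^sub>Q b = q *\<^sub>Q (a * b)"
    by transfer (metis mult.assoc single_zero_commute)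
qed

end

typedef (overloaded) ('g::group_add) conj_class = "range (\<lambda>x::'g. range (\<lambda>g. g + x - g))"
  by blast

instance conj_class :: ("{group_add, finite}") finite
proof
  have "inj (Rep_conj_class :: 'a conj_class \<Rightarrow> 'a set)"
    by (meson Rep_conj_class_inject injI)
  then show "finite (UNIV :: 'a conj_class set)"
    by (rule finite_imageD[rotated]) simp
qed

lemma central_if_commutes_single:
  fixes z :: "'g::monoid_add \<Rightarrow>\<^sub>0 rat"
  assumes "\<And>g. z * Poly_Mapping.single g 1 = Poly_Mapping.single g 1 * z"
  shows "z * a = a * z"
proof (induction a rule: poly_mapping_single_induct)
  case zero
  show ?case by simp
next
  case (add p k v)
  have "Poly_Mapping.single k v = Poly_Mapping.single 0 v * Poly_Mapping.single k (1::rat)"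
    by (simp add: mult_single)
  then have "z * Poly_Mapping.single k v = Poly_Mapping.single k v * z"
    by (metis assms mult.assoc single_zero_commute)
  with add show ?case by (simp add: distrib_left distrib_right)
qed

lift_definition class_sum :: "'g::{group_add,finite} conj_class \<Rightarrow> 'g group_algebra_center"
  is "\<lambda>c. \<Sum>x\<in>Rep_conj_class c. Poly_Mapping.single x 1"
proof -
  fix c :: "'g conj_class" and a :: "'g \<Rightarrow>\<^sub>0 rat"
  obtain x0 where c: "Rep_conj_class c = range (\<lambda>g. g + x0 - g)"
    using Rep_conj_class[of c] by blast
  have conj: "h + x - h \<in> Rep_conj_class c" if x: "x \<in> Rep_conj_class c" for h x
  proof -
    obtain g where "x = g + x0 - g" using x c by auto
    then have "h + x - h = (h + g) + x0 - (h + g)"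
      by (simp add: diff_conv_add_uminus minus_add add.assoc del: add_uminus_conv_diff)
    then show ?thesis using c by blast
  qed
  show "(\<Sum>x\<in>Rep_conj_class c. Poly_Mapping.single x 1) * a
      = a * (\<Sum>x\<in>Rep_conj_class c. Poly_Mapping.single x 1)"
  proof (rule central_if_commutes_single)
    fix h :: 'g
    have "(\<Sum>x\<in>Rep_conj_class c. Poly_Mapping.single (x + h) (1::rat))
        = (\<Sum>x\<in>Rep_conj_class c. Poly_Mapping.single (h + x) 1)"
    proof (rule sum.reindex_bij_witness[of _ "\<lambda>x. h + x - h" "\<lambda>x. - h + x - (- h)"])
      fix x assume x: "x \<in> Rep_conj_class c"
      show "h + (- h + x - (- h)) - h = x" "- h + (h + x - h) - (- h) = x"
        by (simp_all only: diff_conv_add_uminus add.assoc) simp_all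
      show "- h + x - (- h) \<in> Rep_conj_class c" "h + x - h \<in> Rep_conj_class c"
        using conj x by blast+
      show "Poly_Mapping.single (h + (- h + x - (- h))) (1::rat) = Poly_Mapping.single (x + h) 1"
        by (simp only: diff_conv_add_uminus add.assoc minus_minus add_minus_cancel)
    qed
    then show "(\<Sum>x\<in>Rep_conj_class c. Poly_Mapping.single x (1::rat)) * Poly_Mapping.single h 1
        = Poly_Mapping.single h 1 * (\<Sum>x\<in>Rep_conj_class c. Poly_Mapping.single x 1)"
      by (simp add: sum_distrib_left sum_distrib_right mult_single)
  qed
qed

section \<open>Universal enveloping algebras\<close>

instantiation list :: (type) monoid_add
begin

definition zero_list_def: "(0 :: 'a list) = []"
definition plus_list_def: "(xs :: 'a list) + ys = xs @ ys"

instance by standard (simp_all add: zero_list_def plus_list_def)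

end

text \<open>
  With the monoid structure above (concatenation), \<open>'a list \<Rightarrow>\<^sub>0 rat\<close> is the free associative unital
  algebra on the set \<open>'a\<close>.  An associative algebra \<open>'a\<close> is regarded as a Lie algebra under the
  commutator bracket.  Its universal enveloping algebra is the tensor algebra modulo
  \<open>x \<otimes> y - y \<otimes> x - [x, y]\<close>; here the relations of the tensor algebra (linearity of the
  generators) and those of the enveloping algebra are imposed together on the free algebra.
\<close>

abbreviation free_gen :: "'a \<Rightarrow> ('a list \<Rightarrow>\<^sub>0 rat)"
  where "free_gen x \<equiv> Poly_Mapping.single [x] 1"

inductive_set uea_ideal :: "('a::rat_algebra_1 list \<Rightarrow>\<^sub>0 rat) set" where
  uea_ideal_add_gen: "free_gen (x + y) - free_gen x - free_gen y \<in> uea_ideal"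
| uea_ideal_scale_gen: "free_gen (q *\<^sub>Q x) - Poly_Mapping.single 0 q * free_gen x \<in> uea_ideal"
| uea_ideal_bracket:
    "free_gen x * free_gen y - free_gen y * free_gen x - free_gen (x * y - y * x) \<in> uea_ideal"
| uea_ideal_add: "p \<in> uea_ideal \<Longrightarrow> q \<in> uea_ideal \<Longrightarrow> p + q \<in> uea_ideal"
| uea_ideal_mult_left: "p \<in> uea_ideal \<Longrightarrow> r * p \<in> uea_ideal"
| uea_ideal_mult_right: "p \<in> uea_ideal \<Longrightarrow> p * r \<in> uea_ideal"

lemma uea_ideal_zero: "0 \<in> uea_ideal"
  using uea_ideal_mult_left[OF uea_ideal_bracket, of 0] by simp

lemma uea_ideal_uminus: "p \<in> uea_ideal \<Longrightarrow> - p \<in> uea_ideal"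
  using uea_ideal_mult_left[of p "- 1"] by simp

lemma uea_ideal_diff: "p \<in> uea_ideal \<Longrightarrow> q \<in> uea_ideal \<Longrightarrow> p - q \<in> uea_ideal"
  using uea_ideal_add[OF _ uea_ideal_uminus, of p q] by simp

lemma lookup_times_Nil:
  fixes p q :: "'a list \<Rightarrow>\<^sub>0 rat"
  shows "Poly_Mapping.lookup (p * q) [] = Poly_Mapping.lookup p [] * Poly_Mapping.lookup q []"
proof (induction p rule: poly_mapping_single_induct)
  case zero
  show ?case by simp
next
  case (add p k v)
  have "Poly_Mapping.lookup (Poly_Mapping.single k v * q) []
      = Poly_Mapping.lookup (Poly_Mapping.single k v) [] * Poly_Mapping.lookup q []"
    by (induction q rule: poly_mapping_single_induct)
      (auto simp: mult_single lookup_single when_def plus_list_def lookup_add distrib_left)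
  with add show ?case by (simp add: distrib_right lookup_add)
qed

lemma uea_ideal_lookup_Nil: "p \<in> uea_ideal \<Longrightarrow> Poly_Mapping.lookup p [] = 0"
  by (induction rule: uea_ideal.induct)
    (auto simp: lookup_times_Nil lookup_add lookup_minus lookup_single)

lemma one_notin_uea_ideal: "1 \<notin> uea_ideal"
  using uea_ideal_lookup_Nil[of 1] by (auto simp: lookup_one zero_list_def)

quotient_type (overloaded) 'a uea =
  "'a::rat_algebra_1 list \<Rightarrow>\<^sub>0 rat" / "\<lambda>p q. p - q \<in> uea_ideal"
proof (rule equivpI)
  show "reflp (\<lambda>p q. p - q \<in> (uea_ideal :: ('a list \<Rightarrow>\<^sub>0 rat) set))"
    by (simp add: reflp_def uea_ideal_zero)
  show "symp (\<lambda>p q. p - q \<in> (uea_ideal :: ('a list \<Rightarrow>\<^sub>0 rat) set))"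
    by (metis (no_types, lifting) minus_diff_eq sympI uea_ideal_uminus)
  show "transp (\<lambda>p q. p - q \<in> (uea_ideal :: ('a list \<Rightarrow>\<^sub>0 rat) set))"
  proof (rule transpI)
    fix p q r :: "'a list \<Rightarrow>\<^sub>0 rat"
    assume "p - q \<in> uea_ideal" "q - r \<in> uea_ideal"
    then show "p - r \<in> uea_ideal" using uea_ideal_add[of "p - q" "q - r"] by simp
  qed
qed

instantiation uea :: (rat_algebra_1) rat_algebra_1
begin

lift_definition zero_uea :: "'a uea" is 0 .
lift_definition one_uea :: "'a uea" is 1 .
lift_definition plus_uea :: "'a uea \<Rightarrow> 'a uea \<Rightarrow> 'a uea" is "(+)"
proof -
  fix p p' q q' :: "'a list \<Rightarrow>\<^sub>0 rat"
  assume "p - p' \<in> uea_ideal" "q - q' \<in> uea_ideal"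
  from uea_ideal_add[OF this] show "p + q - (p' + q') \<in> uea_ideal"
    by (simp add: algebra_simps)
qed
lift_definition uminus_uea :: "'a uea \<Rightarrow> 'a uea" is uminus
proof -
  fix p p' :: "'a list \<Rightarrow>\<^sub>0 rat"
  assume "p - p' \<in> uea_ideal"
  from uea_ideal_uminus[OF this] show "- p - - p' \<in> uea_ideal" by simp
qed
lift_definition minus_uea :: "'a uea \<Rightarrow> 'a uea \<Rightarrow> 'a uea" is "(-)"
proof -
  fix p p' q q' :: "'a list \<Rightarrow>\<^sub>0 rat"
  assume "p - p' \<in> uea_ideal" "q - q' \<in> uea_ideal"
  from uea_ideal_diff[OF this] show "p - q - (p' - q') \<in> uea_ideal"
    by (simp add: algebra_simps)
qed
lift_definition times_uea :: "'a uea \<Rightarrow> 'a uea \<Rightarrow> 'a uea" is "(*)"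
proof -
  fix p p' q q' :: "'a list \<Rightarrow>\<^sub>0 rat"
  assume "p - p' \<in> uea_ideal" "q - q' \<in> uea_ideal"
  then have "(p - p') * q + p' * (q - q') \<in> uea_ideal"
    by (simp add: uea_ideal.intros)
  then show "p * q - p' * q' \<in> uea_ideal"
    by (simp add: algebra_simps)
qed
lift_definition scaleQ_uea :: "rat \<Rightarrow> 'a uea \<Rightarrow> 'a uea" is "\<lambda>q p. Poly_Mapping.single 0 q * p"
  by (simp add: uea_ideal_mult_left flip: right_diff_distrib)

instance
proof
  fix a b c :: "'a uea" and p q :: rat
  show "a * b * c = a * (b * c)" by transfer (simp add: mult.assoc uea_ideal_zero)
  show "1 * a = a" by transfer (simp add: uea_ideal_zero)
  show "a * 1 = a" by transfer (simp add: uea_ideal_zero)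
  show "a + b + c = a + (b + c)" by transfer (simp add: add.assoc uea_ideal_zero)
  show "a + b = b + a" by transfer (simp add: add.commute uea_ideal_zero)
  show "0 + a = a" by transfer (simp add: uea_ideal_zero)
  show "- a + a = 0" by transfer (simp add: uea_ideal_zero)
  show "a - b = a + - b" by transfer (simp add: uea_ideal_zero)
  show "(a + b) * c = a * c + b * c" by transfer (simp add: distrib_right uea_ideal_zero)
  show "a * (b + c) = a * b + a * c" by transfer (simp add: distrib_left uea_ideal_zero)
  show "(0::'a uea) \<noteq> 1"
    by transfer (use one_notin_uea_ideal uea_ideal_uminus[of "- 1"] in auto)
  show "q *\<^sub>Q (a + b) = q *\<^sub>Q a + q *\<^sub>Q b"
    by transfer (simp add: distrib_left uea_ideal_zero)
  show "(p + q) *\<^sub>Q a = p *\<^sub>Q a + q *\<^sub>Q a"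
    by transfer (simp add: distrib_right single_add uea_ideal_zero)
  show "p *\<^sub>Q q *\<^sub>Q a = (p * q) *\<^sub>Q a"
    by transfer (simp add: mult_single uea_ideal_zero flip: mult.assoc)
  show "1 *\<^sub>Q a = a" by transfer (simp add: uea_ideal_zero)
  show "q *\<^sub>Q a * b = q *\<^sub>Q (a * b)" by transfer (simp add: mult.assoc uea_ideal_zero)
  show "a * q *\<^sub>Q b = q *\<^sub>Q (a * b)"
  proof transfer
    fix a b :: "'a list \<Rightarrow>\<^sub>0 rat" and q :: rat
    have "a * (Poly_Mapping.single 0 q * b) = Poly_Mapping.single 0 q * (a * b)"
      by (metis mult.assoc single_zero_commute)
    then show "a * (Poly_Mapping.single 0 q * b) - Poly_Mapping.single 0 q * (a * b) \<in> uea_ideal"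
      by (simp add: uea_ideal_zero)
  qed
qed

end

lift_definition uea_gen :: "'a::rat_algebra_1 \<Rightarrow> 'a uea" is free_gen .

section \<open>Formal power series in finitely many variables\<close>

typedef ('v, 'a) mfps = "UNIV :: (('v \<Rightarrow> nat) \<Rightarrow> 'a) set"
  morphisms mfps_nth Abs_mfps ..

setup_lifting type_definition_mfps

lemma finite_atMost_fun_nat: "finite {..N :: 'v::finite \<Rightarrow> nat}"
proof -
  have "{..N} \<subseteq> Pi\<^sub>E UNIV (\<lambda>v. {..N v})" by (auto simp: le_fun_def)
  then show ?thesis by (rule finite_subset) (simp add: finite_PiE)
qed

instantiation mfps :: (finite, ring_1) ring_1
begin

lift_definition zero_mfps :: "('a, 'b) mfps" is "\<lambda>_. 0" .
lift_definition one_mfps :: "('a, 'b) mfps" is "\<lambda>N. if N = (\<lambda>_. 0) then 1 else 0" .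
lift_definition plus_mfps :: "('a, 'b) mfps \<Rightarrow> ('a, 'b) mfps \<Rightarrow> ('a, 'b) mfps"
  is "\<lambda>f g N. f N + g N" .
lift_definition uminus_mfps :: "('a, 'b) mfps \<Rightarrow> ('a, 'b) mfps" is "\<lambda>f N. - f N" .
lift_definition minus_mfps :: "('a, 'b) mfps \<Rightarrow> ('a, 'b) mfps \<Rightarrow> ('a, 'b) mfps"
  is "\<lambda>f g N. f N - g N" .
lift_definition times_mfps :: "('a, 'b) mfps \<Rightarrow> ('a, 'b) mfps \<Rightarrow> ('a, 'b) mfps"
  is "\<lambda>f g N. \<Sum>A\<in>{..N}. f A * g (N - A)" .

instance
proof
  fix f g h :: "('a, 'b) mfps"
  show "f * g * h = f * (g * h)"
  proof (transfer, rule ext)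
    fix f g h :: "('a \<Rightarrow> nat) \<Rightarrow> 'b" and N :: "'a \<Rightarrow> nat"
    have "(\<Sum>B\<in>{..N}. (\<Sum>A\<in>{..B}. f A * g (B - A)) * h (N - B))
        = (\<Sum>(B, A)\<in>Sigma {..N} (\<lambda>B. {..B}). f A * (g (B - A) * h (N - B)))"
      by (simp add: sum.Sigma finite_atMost_fun_nat sum_distrib_right mult.assoc)
    also have "\<dots> = (\<Sum>(A, C)\<in>Sigma {..N} (\<lambda>A. {..N - A}). f A * (g C * h (N - A - C)))"
    proof (rule sum.reindex_bij_witness[of _ "\<lambda>(A, C). (\<lambda>v. A v + C v, A)" "\<lambda>(B, A). (A, B - A)"])
      fix x assume "x \<in> Sigma {..N} (\<lambda>B. {..B})"
      then obtain B A where x: "x = (B, A)" and BN: "\<And>v. B v \<le> N v" and AB: "\<And>v. A v \<le> B v"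
        by (auto simp: le_fun_def)
      show "(case case x of (B, A) \<Rightarrow> (A, B - A) of (A, C) \<Rightarrow> (\<lambda>v. A v + C v, A)) = x"
        by (simp add: x AB)
      show "(case x of (B, A) \<Rightarrow> (A, B - A)) \<in> Sigma {..N} (\<lambda>A. {..N - A})"
        using AB BN by (auto simp: x le_fun_def diff_le_mono intro: order_trans)
      have "N - A - (B - A) = N - B"
      proof
        fix v show "(N - A - (B - A)) v = (N - B) v" using AB[of v] BN[of v] by simp
      qed
      then show "(case case x of (B, A) \<Rightarrow> (A, B - A) of (A, C) \<Rightarrow> f A * (g C * h (N - A - C)))
          = (case x of (B, A) \<Rightarrow> f A * (g (B - A) * h (N - B)))"
        by (simp add: x)
    next
      fix y assume "y \<in> Sigma {..N} (\<lambda>A. {..N - A})"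
      then obtain A C where y: "y = (A, C)" and AN: "\<And>v. A v \<le> N v"
          and CN: "\<And>v. C v \<le> N v - A v"
        by (auto simp: le_fun_def)
      show "(case case y of (A, C) \<Rightarrow> (\<lambda>v. A v + C v, A) of (B, A) \<Rightarrow> (A, B - A)) = y"
        by (auto simp: y)
      have "A v + C v \<le> N v" for v using AN[of v] CN[of v] by simp
      then show "(case y of (A, C) \<Rightarrow> (\<lambda>v. A v + C v, A)) \<in> Sigma {..N} (\<lambda>B. {..B})"
        by (auto simp: y le_fun_def)
    qed
    also have "\<dots> = (\<Sum>A\<in>{..N}. f A * (\<Sum>C\<in>{..N - A}. g C * h (N - A - C)))"
      by (simp add: sum.Sigma finite_atMost_fun_nat sum_distrib_left)
    finally show "(\<Sum>B\<in>{..N}. (\<Sum>A\<in>{..B}. f A * g (B - A)) * h (N - B))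
        = (\<Sum>A\<in>{..N}. f A * (\<Sum>C\<in>{..N - A}. g C * h (N - A - C)))" .
  qed
  show "1 * f = f"
  proof (transfer, rule ext)
    fix f :: "('a \<Rightarrow> nat) \<Rightarrow> 'b" and N :: "'a \<Rightarrow> nat"
    have "(\<Sum>A\<in>{..N}. (if A = (\<lambda>_. 0) then 1 else 0) * f (N - A))
        = (\<Sum>A\<in>{..N}. if A = (\<lambda>_. 0) then f (N - (\<lambda>_. 0)) else 0)"
      by (rule sum.cong) auto
    also have "\<dots> = f N"
      by (simp add: sum.delta finite_atMost_fun_nat le_fun_def fun_diff_def)
    finally show "(\<Sum>A\<in>{..N}. (if A = (\<lambda>_. 0) then 1 else 0) * f (N - A)) = f N" .
  qed
  show "f * 1 = f"
  proof (transfer, rule ext)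
    fix f :: "('a \<Rightarrow> nat) \<Rightarrow> 'b" and N :: "'a \<Rightarrow> nat"
    have "(\<Sum>A\<in>{..N}. f A * (if N - A = (\<lambda>_. 0) then 1 else 0))
        = (\<Sum>A\<in>{..N}. if A = N then f N else 0)"
      by (rule sum.cong) (auto simp: le_fun_def fun_eq_iff intro!: arg_cong[of _ _ f] antisym)
    also have "\<dots> = f N"
      by (simp add: sum.delta finite_atMost_fun_nat)
    finally show "(\<Sum>A\<in>{..N}. f A * (if N - A = (\<lambda>_. 0) then 1 else 0)) = f N" .
  qed
  show "f + g + h = f + (g + h)" by transfer (simp add: add.assoc)
  show "f + g = g + f" by transfer (simp add: add.commute)
  show "0 + f = f" by transfer simp
  show "- f + f = 0" by transfer simp
  show "f - g = f + - g" by transfer simp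
  show "(f + g) * h = f * h + g * h" by transfer (simp add: distrib_right sum.distrib)
  show "f * (g + h) = f * g + f * h" by transfer (simp add: distrib_left sum.distrib)
  show "(0 :: ('a, 'b) mfps) \<noteq> 1" by transfer (auto simp: fun_eq_iff)
qed

end

text \<open>\<open>mfps_monom a v\<close> is the series \<open>a x\<^sub>v\<close>.\<close>

lift_definition mfps_monom :: "'a::zero \<Rightarrow> 'v \<Rightarrow> ('v, 'a) mfps"
  is "\<lambda>a v N. if N = (\<lambda>w. if w = v then 1 else 0) then a else 0" .

lift_definition mfps_map :: "('a \<Rightarrow> 'b) \<Rightarrow> ('v, 'a) mfps \<Rightarrow> ('v, 'b) mfps"
  is "\<lambda>\<phi> f N. \<phi> (f N)" .

text \<open>
  \<open>mfps_exp f\<close> and \<open>mfps_log f\<close> are meant for series \<open>f\<close> with constant term 0 and 1, respectively.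
  The families of powers involved are then locally finite, so that in each degree
  \<^const>\<open>Sum_any\<close> sums only finitely many nonzero terms.
\<close>

definition mfps_exp :: "('v::finite, 'a::rat_algebra_1) mfps \<Rightarrow> ('v, 'a) mfps"
  where "mfps_exp f = Abs_mfps (\<lambda>N. Sum_any (\<lambda>n. (1 / fact n) *\<^sub>Q mfps_nth (f ^ n) N))"

definition mfps_log :: "('v::finite, 'a::rat_algebra_1) mfps \<Rightarrow> ('v, 'a) mfps"
  where "mfps_log f = Abs_mfps (\<lambda>N.
    Sum_any (\<lambda>n. ((- 1) ^ n / of_nat (Suc n)) *\<^sub>Q mfps_nth ((f - 1) ^ Suc n) N))"

section \<open>The ring of the coefficients\<close>

definition T_series ::
    "('v, 'a::rat_algebra_1) mfps \<Rightarrow> ('v, 'a uea) mfps"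
  where "T_series = mfps_map uea_gen"

definition B_coeff ::
    "('g::{group_add,finite} conj_class \<Rightarrow> nat) \<Rightarrow> 'g group_algebra_center uea"
  where "B_coeff = mfps_nth (mfps_exp (T_series (mfps_log
    (1 + (\<Sum>c\<in>UNIV. mfps_monom (class_sum c) c)))))"

definition R_set :: "'g::{group_add,finite} group_algebra_center uea set"
  where "R_set = {\<Sum>N\<in>S. of_int (k N) * B_coeff N | S k. finite S}"

definition R_ring :: "'g::{group_add,finite} group_algebra_center uea ring"
  where "R_ring = ring_of_type_algebra\<lparr>carrier := R_set\<rparr>"

end

theory Submission
  imports Defs
begin

text \<open>
  Write \<open>U\<close> for the enveloping algebra of the centre of the rational group algebra and \<open>R\<close> for the
  integral span of the \<open>B_coeff N\<close>. The class sums are a \<open>\<rat>\<close>-basis of the centre, so \<open>U\<close> is the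
  polynomial algebra over \<open>\<rat>\<close> on their images \<open>T(c)\<close>. A homomorphism \<open>R \<rightarrow> F\<close> with prescribed values
  at the \<open>T(c)\<close> exists since the corresponding homomorphism on \<open>U\<close> can be restricted
  (\<open>uea_universal\<close>, \<open>ex_ring_hom_R_ring\<close>). It is unique since every element of \<open>U\<close> has a positive
  integer multiple that is an integral polynomial in the \<open>T(c)\<close> (\<open>uea_denominator\<close>), and positive
  integers can be cancelled in \<open>F\<close> (\<open>ring_hom_R_ring_eqI\<close>).

  Both directions rely on \<open>R\<close> being a subring of \<open>U\<close>, and the substance is closure under
  multiplication (\<open>B_coeff_mult_in_R_set\<close>). The generating series \<open>E(x)\<close> of the \<open>B_coeff N\<close> is the
  value of \<open>f \<mapsto> exp (T (log (1 + f)))\<close> at the generic element \<open>\<Sum>\<^sub>c c x\<^sub>c\<close>. The logarithm turns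
  products into sums, \<open>T\<close> is additive, and the exponential turns sums into products; hence
  \<open>E(x) E(y) = E(z)\<close>, where the \<open>z\<^sub>c\<close> are the coordinates of
  \<open>(1 + \<Sum>\<^sub>c c x\<^sub>c) (1 + \<Sum>\<^sub>c c y\<^sub>c) - 1\<close>. These are integral polynomials in \<open>x\<close> and \<open>y\<close>, because the
  structure constants of the class sums are integers. Comparing coefficients expresses each product
  \<open>B_coeff M * B_coeff N\<close> as an integral combination of the \<open>B_coeff K\<close>.

  The functional equations of \<open>exp\<close> and \<open>log\<close> follow from the uniqueness of solutions of differential
  equations for the Euler derivation (\<open>euler_ode_unique\<close>). Reading \<open>E(z)\<close> as the result of
  substituting \<open>z\<close> into the series \<open>E\<close> requires that substitution is a ring homomorphism that commutes
  with \<open>exp\<close>, \<open>log\<close> and \<open>T\<close> (\<open>mfps_subst_exp_T_log\<close>).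
\<close>

section \<open>Scalar multiplication by rational numbers\<close>

lemma scaleQ_zero_right [simp]: "q *\<^sub>Q (0::'a::rat_algebra_1) = 0"
  using scaleQ_add_right[of q 0 "0::'a"] by simp

lemma scaleQ_zero_left [simp]: "0 *\<^sub>Q (x::'a::rat_algebra_1) = 0"
  using scaleQ_add_left[of 0 0 x] by simp

lemma scaleQ_minus_left: "(- q) *\<^sub>Q (x::'a::rat_algebra_1) = - (q *\<^sub>Q x)"
  using scaleQ_add_left[of q "- q" x] by (simp add: eq_neg_iff_add_eq_0 add.commute)

lemma scaleQ_sum_right: "q *\<^sub>Q (\<Sum>i\<in>S. f i) = (\<Sum>i\<in>S. q *\<^sub>Q (f i :: 'a::rat_algebra_1))"
  by (induction S rule: infinite_finite_induct) (simp_all add: scaleQ_add_right)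

lemma scaleQ_sum_left: "(\<Sum>i\<in>S. f i) *\<^sub>Q x = (\<Sum>i\<in>S. f i *\<^sub>Q (x :: 'a::rat_algebra_1))"
  by (induction S rule: infinite_finite_induct) (simp_all add: scaleQ_add_left)

lemma scaleQ_of_nat: "of_nat n *\<^sub>Q (x::'a::rat_algebra_1) = of_nat n * x"
  by (induction n) (simp_all add: scaleQ_add_left scaleQ_one distrib_right)

lemma scaleQ_of_int: "of_int k *\<^sub>Q (x::'a::rat_algebra_1) = of_int k * x"
  by (cases k rule: int_cases2) (simp_all add: scaleQ_of_nat scaleQ_minus_left)

lemma scaleQ_mult_scaleQ: "(p *\<^sub>Q x) * (q *\<^sub>Q y) = (p * q) *\<^sub>Q (x * y :: 'a::rat_algebra_1)"
  by (simp add: mult_scaleQ_left mult_scaleQ_right scaleQ_scaleQ mult.commute)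

lemma of_nat_mult_eq_0:
  assumes "of_nat n * (x::'a::rat_algebra_1) = 0" "n \<noteq> 0"
  shows "x = 0"
proof -
  have "x = (1 / of_nat n) *\<^sub>Q of_nat n *\<^sub>Q x"
    using assms(2) by (simp add: scaleQ_scaleQ scaleQ_one)
  then show ?thesis using assms(1) by (simp add: scaleQ_of_nat)
qed

section \<open>The enveloping algebra of a commutative algebra\<close>

lemma uea_gen_add: "uea_gen (x + y) = uea_gen x + uea_gen y"
  by transfer (use uea_ideal_add_gen in \<open>simp add: diff_diff_eq\<close>)

lemma uea_gen_scaleQ: "uea_gen (q *\<^sub>Q x) = q *\<^sub>Q uea_gen x"
  by transfer (rule uea_ideal_scale_gen)

lemma uea_gen_zero [simp]: "uea_gen 0 = 0"
  using uea_gen_scaleQ[of 0 0] by simp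

lemma uea_gen_sum: "uea_gen (\<Sum>i\<in>S. f i) = (\<Sum>i\<in>S. uea_gen (f i))"
  by (induction S rule: infinite_finite_induct) (simp_all add: uea_gen_add)

lemma uea_gen_bracket: "uea_gen x * uea_gen y - uea_gen y * uea_gen x = uea_gen (x * y - y * x)"
  by transfer (rule uea_ideal_bracket)

text \<open>
  The free algebra is spanned by words, and a word is a product of generators applied to 1.
\<close>

lemma uea_induct [case_names one gen add scale]:
  assumes one: "P 1"
    and gen: "\<And>a u. P u \<Longrightarrow> P (uea_gen a * u)"
    and add: "\<And>u v. P u \<Longrightarrow> P v \<Longrightarrow> P (u + v)"
    and scale: "\<And>q u. P u \<Longrightarrow> P (q *\<^sub>Q u)"
  shows "P (u :: 'a::rat_algebra_1 uea)"
proof -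
  have mono: "P (abs_uea (Poly_Mapping.single w v))" for w and v :: rat
  proof (induction w)
    case Nil
    have "abs_uea (Poly_Mapping.single [] v) = v *\<^sub>Q (1 :: 'a uea)"
      by (simp add: one_uea.abs_eq scaleQ_uea.abs_eq zero_list_def)
    then show ?case using scale[OF one] by simp
  next
    case (Cons a w)
    have "abs_uea (Poly_Mapping.single (a # w) v) = uea_gen a * abs_uea (Poly_Mapping.single w v)"
      by (simp add: uea_gen.abs_eq times_uea.abs_eq mult_single plus_list_def)
    then show ?case using gen[OF Cons] by simp
  qed
  have "P (abs_uea p)" for p
  proof (induction p rule: poly_mapping_single_induct)
    case zero
    show ?case using scale[OF one, of 0] by (simp add: zero_uea.abs_eq)
  next
    case (add p k v)
    then show ?case using assms(3)[OF mono add] by (simp add: plus_uea.abs_eq)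
  qed
  then show ?thesis by (induction u rule: uea.abs_induct)
qed

text \<open>
  For a commutative algebra the bracket relations say exactly that the generators commute.
\<close>

instance uea :: ("{rat_algebra_1, comm_ring_1}") comm_ring_1
proof
  fix a b c :: "'a uea"
  have gen_commute: "uea_gen x * v = v * uea_gen x" for x and v :: "'a uea"
  proof (induction v rule: uea_induct)
    case (gen y v)
    have "uea_gen x * uea_gen y = uea_gen y * uea_gen x"
      using uea_gen_bracket[of x y] by (simp add: mult.commute)
    then show ?case by (metis gen mult.assoc)
  qed (simp_all add: distrib_left distrib_right mult_scaleQ_left mult_scaleQ_right)
  show "a * b = b * a"
  proof (induction a rule: uea_induct)
    case (gen x u)
    then show ?case by (metis gen_commute mult.assoc)
  qed (simp_all add: distrib_left distrib_right mult_scaleQ_left mult_scaleQ_right)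
  show "1 * a = a" by simp
  show "(a + b) * c = a * c + b * c" by (rule distrib_right)
qed

text \<open>
  Evaluation of words at \<open>l\<close> is a homomorphism on the free algebra. Linearity of \<open>l\<close> kills the
  first two kinds of relations; the bracket relations are killed because source and target are both
  commutative.
\<close>

lemma uea_universal:
  fixes l :: "'a::{rat_algebra_1,comm_ring_1} \<Rightarrow> 'f::field_char_0"
  assumes add: "\<And>x y. l (x + y) = l x + l y"
    and scale: "\<And>q x. l (q *\<^sub>Q x) = of_rat q * l x"
  obtains \<phi> where "\<phi> 1 = 1" "\<And>u v. \<phi> (u + v) = \<phi> u + \<phi> v" "\<And>u v. \<phi> (u * v) = \<phi> u * \<phi> v"
    "\<And>x. \<phi> (uea_gen x) = l x"
proof -
  define ev where "ev p = Sum_any (\<lambda>w. of_rat (Poly_Mapping.lookup p w) * prod_list (map l w))"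
    for p :: "'a list \<Rightarrow>\<^sub>0 rat"
  have fin: "finite {w. of_rat (Poly_Mapping.lookup p w) * prod_list (map l w) \<noteq> 0}"
    for p :: "'a list \<Rightarrow>\<^sub>0 rat"
    by (rule finite_subset[OF _ finite_lookup[of p]]) auto
  have ev_add: "ev (p + q) = ev p + ev q" for p q
    unfolding ev_def Sum_any.distrib[OF fin fin, symmetric]
    by (simp add: lookup_add of_rat_add distrib_right)
  have ev_single: "ev (Poly_Mapping.single w v) = of_rat v * prod_list (map l w)" for w v
  proof -
    have "ev (Poly_Mapping.single w v) = Sum_any (\<lambda>w'. (of_rat v * prod_list (map l w)) when w' = w)"
      unfolding ev_def by (intro Sum_any.cong) (auto simp: lookup_single when_def)
    then show ?thesis by simp
  qed
  have ev_zero: "ev 0 = 0" by (simp add: ev_def)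
  have ev_mult: "ev (p * q) = ev p * ev q" for p q
  proof (induction p rule: poly_mapping_single_induct)
    case (add p k v)
    have "ev (Poly_Mapping.single k v * q) = ev (Poly_Mapping.single k v) * ev q"
      by (induction q rule: poly_mapping_single_induct)
        (simp_all add: ev_zero distrib_left ev_add mult_single ev_single plus_list_def of_rat_mult)
    with add show ?case by (simp add: distrib_right ev_add)
  qed (simp add: ev_zero)
  have ev_diff: "ev (p - q) = ev p - ev q" for p q
    using ev_add[of "p - q" q] by simp
  have ideal: "ev p = 0" if "p \<in> uea_ideal" for p
    using that
  proof induction
    case (uea_ideal_add_gen x y)
    show ?case by (simp add: ev_diff ev_single add)
  next
    case (uea_ideal_scale_gen q x)
    show ?case by (simp add: ev_diff ev_mult ev_single scale zero_list_def)
  next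
    case (uea_ideal_bracket x y)
    have "l 0 = 0" using add[of 0 0] by simp
    moreover have "x * y - y * x = 0" by (simp add: mult.commute)
    ultimately have "ev (free_gen (x * y - y * x)) = 0" by (simp only: ev_single) simp
    then show ?case by (simp only: ev_diff ev_mult) (simp add: ev_single)
  qed (simp_all add: ev_add ev_mult)
  define \<phi> where "\<phi> u = ev (rep_uea u)" for u
  have \<phi>: "\<phi> (abs_uea p) = ev p" for p
  proof -
    have "rep_uea (abs_uea p) - p \<in> uea_ideal"
      using Quotient_rep_abs[OF Quotient_uea, of p] by (simp add: uea_ideal_zero)
    then show ?thesis using ideal[of "rep_uea (abs_uea p) - p"] by (simp add: \<phi>_def ev_diff)
  qed
  show thesis
  proof (rule that[of \<phi>])
    show "\<phi> 1 = 1"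
      using ev_single[of 0 1] unfolding single_one one_uea.abs_eq \<phi> by (simp add: zero_list_def)
    show "\<phi> (u + v) = \<phi> u + \<phi> v" for u v
      by (induction u rule: uea.abs_induct, induction v rule: uea.abs_induct)
        (simp add: plus_uea.abs_eq \<phi> ev_add)
    show "\<phi> (u * v) = \<phi> u * \<phi> v" for u v
      by (induction u rule: uea.abs_induct, induction v rule: uea.abs_induct)
        (simp add: times_uea.abs_eq \<phi> ev_mult)
    show "\<phi> (uea_gen x) = l x" for x
      by (simp add: uea_gen.abs_eq \<phi> ev_single)
  qed
qed

section \<open>Algebra structure and order of vanishing of power series\<close>

lemma mfps_eqI: "(\<And>N. mfps_nth f N = mfps_nth g N) \<Longrightarrow> f = g"
  by (simp add: mfps_nth_inject[symmetric] fun_eq_iff)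

lemma mfps_nth_Abs [simp]: "mfps_nth (Abs_mfps f) = f"
  by (simp add: Abs_mfps_inverse)

lemma mfps_nth_simps [simp]:
  fixes f g :: "('v::finite, 'a::ring_1) mfps"
  shows "mfps_nth 0 N = (0::'a)"
    and "mfps_nth (f + g) N = mfps_nth f N + mfps_nth g N"
    and "mfps_nth (f - g) N = mfps_nth f N - mfps_nth g N"
    and "mfps_nth (- f) N = - mfps_nth f N"
  by (simp_all add: zero_mfps.rep_eq plus_mfps.rep_eq minus_mfps.rep_eq uminus_mfps.rep_eq)

lemma mfps_nth_one: "mfps_nth 1 N = (if N = (\<lambda>_. 0) then 1 else 0)"
  by (simp add: one_mfps.rep_eq)

lemma mfps_nth_mult: "mfps_nth (f * g) N = (\<Sum>A\<in>{..N}. mfps_nth f A * mfps_nth g (N - A))"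
  by (simp add: times_mfps.rep_eq)

lemma mfps_nth_sum [simp]:
  "mfps_nth (\<Sum>i\<in>S. f i) N = (\<Sum>i\<in>S. mfps_nth (f i :: ('v::finite, 'a::ring_1) mfps) N)"
  by (induction S rule: infinite_finite_induct) simp_all

lemma mfps_nth_map [simp]: "mfps_nth (mfps_map h f) N = h (mfps_nth f N)"
  by (simp add: mfps_map.rep_eq)

instance mfps :: (finite, comm_ring_1) comm_ring_1
proof
  fix f g h :: "('a, 'b) mfps"
  show "f * g = g * f"
  proof (rule mfps_eqI)
    fix N :: "'a \<Rightarrow> nat"
    have inv: "N - (N - A) = A" if "A \<in> {..N}" for A
      using that by (auto simp: le_fun_def fun_eq_iff)
    show "mfps_nth (f * g) N = mfps_nth (g * f) N"
      unfolding mfps_nth_mult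
      by (rule sum.reindex_bij_witness[of _ "\<lambda>A. N - A" "\<lambda>A. N - A"])
        (auto simp: inv mult.commute, auto simp: le_fun_def)
  qed
qed (simp_all add: distrib_right)

instantiation mfps :: (finite, rat_algebra_1) rat_algebra_1
begin

lift_definition scaleQ_mfps :: "rat \<Rightarrow> ('a, 'b) mfps \<Rightarrow> ('a, 'b) mfps" is "\<lambda>q f N. q *\<^sub>Q f N" .

instance
proof
  fix f g :: "('a, 'b) mfps" and p q :: rat
  show "q *\<^sub>Q (f + g) = q *\<^sub>Q f + q *\<^sub>Q g" by transfer (simp add: scaleQ_add_right)
  show "(p + q) *\<^sub>Q f = p *\<^sub>Q f + q *\<^sub>Q f" by transfer (simp add: scaleQ_add_left)
  show "p *\<^sub>Q q *\<^sub>Q f = (p * q) *\<^sub>Q f" by transfer (simp add: scaleQ_scaleQ)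
  show "1 *\<^sub>Q f = f" by transfer (simp add: scaleQ_one)
  show "q *\<^sub>Q f * g = q *\<^sub>Q (f * g)" by transfer (simp add: mult_scaleQ_left scaleQ_sum_right)
  show "f * q *\<^sub>Q g = q *\<^sub>Q (f * g)" by transfer (simp add: mult_scaleQ_right scaleQ_sum_right)
qed

end

lemma mfps_nth_scaleQ [simp]: "mfps_nth (q *\<^sub>Q f) N = q *\<^sub>Q mfps_nth f N"
  by (simp add: scaleQ_mfps.rep_eq)

definition total_degree :: "('v::finite \<Rightarrow> nat) \<Rightarrow> nat"
  where "total_degree N = (\<Sum>v\<in>UNIV. N v)"

lemma total_degree_eq_0_iff: "total_degree N = 0 \<longleftrightarrow> N = (\<lambda>_. 0)"
  by (auto simp: total_degree_def fun_eq_iff)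

lemma total_degree_zero [simp]: "total_degree (\<lambda>_. 0) = 0"
  by (simp add: total_degree_eq_0_iff)

lemma total_degree_split:
  assumes "A \<le> N"
  shows "total_degree N = total_degree A + total_degree (N - A)"
proof -
  have "N v = A v + (N v - A v)" for v using assms by (simp add: le_fun_def)
  then show ?thesis unfolding total_degree_def by (simp add: sum.distrib[symmetric])
qed

lemma finite_total_degree_le: "finite {N :: 'v::finite \<Rightarrow> nat. total_degree N \<le> d}"
proof (rule finite_subset[OF _ finite_atMost_fun_nat])
  show "{N :: 'v \<Rightarrow> nat. total_degree N \<le> d} \<subseteq> {..\<lambda>_. d}"
  proof (clarsimp simp: le_fun_def)
    fix N :: "'v \<Rightarrow> nat" and v assume "total_degree N \<le> d"
    moreover have "N v \<le> total_degree N"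
      unfolding total_degree_def by (rule member_le_sum) auto
    ultimately show "N v \<le> d" by simp
  qed
qed

definition vanishes_below :: "nat \<Rightarrow> ('v::finite, 'a::zero) mfps \<Rightarrow> bool"
  where "vanishes_below k f \<longleftrightarrow> (\<forall>N. total_degree N < k \<longrightarrow> mfps_nth f N = 0)"

lemma vanishes_belowI: "(\<And>N. total_degree N < k \<Longrightarrow> mfps_nth f N = 0) \<Longrightarrow> vanishes_below k f"
  by (simp add: vanishes_below_def)

lemma vanishes_belowD: "vanishes_below k f \<Longrightarrow> total_degree N < k \<Longrightarrow> mfps_nth f N = 0"
  by (simp add: vanishes_below_def)

lemma vanishes_below_mult:
  fixes f g :: "('v::finite, 'a::ring_1) mfps"
  assumes f: "vanishes_below k f" and g: "vanishes_below l g"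
  shows "vanishes_below (k + l) (f * g)"
proof (rule vanishes_belowI)
  fix N :: "'v \<Rightarrow> nat" assume N: "total_degree N < k + l"
  show "mfps_nth (f * g) N = 0"
    unfolding mfps_nth_mult
  proof (intro sum.neutral ballI)
    fix A assume "A \<in> {..N}"
    then have "total_degree A < k \<or> total_degree (N - A) < l"
      using total_degree_split[of A N] N by simp linarith
    then show "mfps_nth f A * mfps_nth g (N - A) = 0"
      using vanishes_belowD[OF f] vanishes_belowD[OF g] by auto
  qed
qed

definition no_constant_term :: "('v, 'a::zero) mfps \<Rightarrow> bool"
  where "no_constant_term f \<longleftrightarrow> mfps_nth f (\<lambda>_. 0) = 0"

lemma vanishes_below_Suc_0_iff: "vanishes_below (Suc 0) f \<longleftrightarrow> no_constant_term f"
  by (auto simp: vanishes_below_def no_constant_term_def total_degree_eq_0_iff)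

lemma vanishes_below_power:
  fixes f :: "('v::finite, 'a::ring_1) mfps"
  assumes "no_constant_term f"
  shows "vanishes_below n (f ^ n)"
proof (induction n)
  case (Suc n)
  show ?case using vanishes_below_mult[of "Suc 0" f n "f ^ n"] Suc assms
    by (simp add: vanishes_below_Suc_0_iff)
qed (simp add: vanishes_below_def)

lemma no_constant_term_add:
  "no_constant_term f \<Longrightarrow> no_constant_term g \<Longrightarrow> no_constant_term (f + g :: ('v::finite, 'a::ring_1) mfps)"
  by (simp add: no_constant_term_def)

lemma mfps_nth_mult_zero:
  fixes f g :: "('v::finite, 'a::ring_1) mfps"
  shows "mfps_nth (f * g) (\<lambda>_. 0) = mfps_nth f (\<lambda>_. 0) * mfps_nth g (\<lambda>_. 0)"
proof -
  have "{..\<lambda>_::'v. 0::nat} = {\<lambda>_. 0}" by (auto simp: le_fun_def)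
  then show ?thesis by (simp add: mfps_nth_mult fun_diff_def)
qed

lemma no_constant_term_mult_left:
  "no_constant_term f \<Longrightarrow> no_constant_term (f * g :: ('v::finite, 'a::ring_1) mfps)"
  by (simp add: no_constant_term_def mfps_nth_mult_zero)

lemma vanishes_below_all_imp_0:
  fixes f :: "('v::finite, 'a::ring_1) mfps"
  shows "(\<And>k. vanishes_below k f) \<Longrightarrow> f = 0"
  by (rule mfps_eqI) (auto simp: vanishes_below_def)

section \<open>Exponential and logarithm as power series in a series\<close>

text \<open>
  The value at \<open>f\<close> of the one-variable series with coefficients \<open>a\<close>, for \<open>f\<close> without constant
  term: then \<open>f ^ n\<close> vanishes below degree \<open>n\<close>.
\<close>

definition mfps_power_series :: "(nat \<Rightarrow> rat) \<Rightarrow> ('v::finite, 'a::rat_algebra_1) mfps \<Rightarrow> ('v, 'a) mfps"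
  where "mfps_power_series a f = Abs_mfps (\<lambda>N. \<Sum>n\<le>total_degree N. a n *\<^sub>Q mfps_nth (f ^ n) N)"

lemma mfps_nth_power_eq_0:
  fixes f :: "('v::finite, 'a::ring_1) mfps"
  shows "no_constant_term f \<Longrightarrow> total_degree N < n \<Longrightarrow> mfps_nth (f ^ n) N = 0"
  using vanishes_below_power vanishes_belowD by blast

text \<open>
  The sum defining a coefficient may be cut off at any index that is at least the degree. This
  reduces every identity about infinite sums below to one about polynomials in \<open>f\<close>.
\<close>

lemma mfps_nth_power_series:
  assumes "no_constant_term f" "total_degree N \<le> d"
  shows "mfps_nth (mfps_power_series a f) N = mfps_nth (\<Sum>n\<le>d. a n *\<^sub>Q f ^ n) N"
proof -
  have "(\<Sum>n\<le>total_degree N. a n *\<^sub>Q mfps_nth (f ^ n) N) = (\<Sum>n\<le>d. a n *\<^sub>Q mfps_nth (f ^ n) N)"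
    using assms by (intro sum.mono_neutral_left) (auto simp: mfps_nth_power_eq_0)
  then show ?thesis by (simp add: mfps_power_series_def)
qed

lemma mfps_nth_power_series_zero: "mfps_nth (mfps_power_series a f) (\<lambda>_. 0) = a 0 *\<^sub>Q 1"
  by (simp add: mfps_power_series_def mfps_nth_one)

definition exp_coeff :: "nat \<Rightarrow> rat" where "exp_coeff n = 1 / fact n"

definition log_coeff :: "nat \<Rightarrow> rat"
  where "log_coeff n = (case n of 0 \<Rightarrow> 0 | Suc m \<Rightarrow> (- 1) ^ m / of_nat (Suc m))"

lemma mfps_exp_conv_power_series:
  fixes f :: "('v::finite, 'a::rat_algebra_1) mfps"
  assumes "no_constant_term f"
  shows "mfps_exp f = mfps_power_series exp_coeff f"
proof (rule mfps_eqI)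
  fix N :: "'v \<Rightarrow> nat"
  have "Sum_any (\<lambda>n. exp_coeff n *\<^sub>Q mfps_nth (f ^ n) N)
      = (\<Sum>n\<le>total_degree N. exp_coeff n *\<^sub>Q mfps_nth (f ^ n) N)"
  proof (rule Sum_any.expand_superset)
    show "{n. exp_coeff n *\<^sub>Q mfps_nth (f ^ n) N \<noteq> 0} \<subseteq> {..total_degree N}"
      using mfps_nth_power_eq_0[OF assms] by (force simp: not_less[symmetric])
  qed simp
  then show "mfps_nth (mfps_exp f) N = mfps_nth (mfps_power_series exp_coeff f) N"
    by (simp add: mfps_exp_def mfps_power_series_def exp_coeff_def)
qed

lemma mfps_log_conv_power_series:
  fixes f :: "('v::finite, 'a::rat_algebra_1) mfps"
  assumes "no_constant_term f"
  shows "mfps_log (1 + f) = mfps_power_series log_coeff f"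
proof (rule mfps_eqI)
  fix N :: "'v \<Rightarrow> nat"
  have "Sum_any (\<lambda>n. ((- 1) ^ n / of_nat (Suc n)) *\<^sub>Q mfps_nth (f ^ Suc n) N)
      = (\<Sum>n\<le>total_degree N. ((- 1) ^ n / of_nat (Suc n)) *\<^sub>Q mfps_nth (f ^ Suc n) N)"
  proof (rule Sum_any.expand_superset)
    show "{n. ((- 1) ^ n / of_nat (Suc n)) *\<^sub>Q mfps_nth (f ^ Suc n) N \<noteq> 0} \<subseteq> {..total_degree N}"
    proof
      fix n assume "n \<in> {n. ((- 1) ^ n / of_nat (Suc n)) *\<^sub>Q mfps_nth (f ^ Suc n) N \<noteq> 0}"
      then have "\<not> total_degree N < Suc n"
        using mfps_nth_power_eq_0[OF assms, of N "Suc n"] by fastforce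
      then show "n \<in> {..total_degree N}" by simp
    qed
  qed simp
  also have "\<dots> = (\<Sum>n\<le>Suc (total_degree N). log_coeff n *\<^sub>Q mfps_nth (f ^ n) N)"
    by (subst sum.atMost_Suc_shift) (simp add: log_coeff_def)
  also have "\<dots> = mfps_nth (mfps_power_series log_coeff f) N"
    by (subst mfps_nth_power_series[OF assms, of N "Suc (total_degree N)"]) auto
  finally show "mfps_nth (mfps_log (1 + f)) N = mfps_nth (mfps_power_series log_coeff f) N"
    by (simp add: mfps_log_def)
qed

section \<open>The functional equations of exponential and logarithm\<close>

text \<open>
  The Euler derivation \<open>\<Sum>\<^sub>v x\<^sub>v \<partial>/\<partial>x\<^sub>v\<close>. It replaces all partial derivatives at once: over a
  \<open>\<rat>\<close>-algebra it vanishes only on constants.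
\<close>

definition euler :: "('v::finite, 'a::ring_1) mfps \<Rightarrow> ('v, 'a) mfps"
  where "euler f = Abs_mfps (\<lambda>N. of_nat (total_degree N) * mfps_nth f N)"

lemma mfps_nth_euler [simp]: "mfps_nth (euler f) N = of_nat (total_degree N) * mfps_nth f N"
  by (simp add: euler_def)

lemma euler_add: "euler (f + g) = euler f + euler g"
  by (rule mfps_eqI) (simp add: distrib_left)

lemma euler_diff: "euler (f - g) = euler f - euler g"
  by (rule mfps_eqI) (simp add: right_diff_distrib)

lemma euler_one [simp]: "euler 1 = 0"
  by (rule mfps_eqI) (simp add: mfps_nth_one)

lemma euler_sum: "euler (\<Sum>i\<in>S. f i) = (\<Sum>i\<in>S. euler (f i))"
  by (rule mfps_eqI) (simp add: sum_distrib_left)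

lemma euler_scaleQ: "euler (q *\<^sub>Q f) = q *\<^sub>Q euler f"
  by (rule mfps_eqI) (simp add: mult_scaleQ_right)

lemma euler_mult:
  fixes f g :: "('v::finite, 'a::ring_1) mfps"
  shows "euler (f * g) = euler f * g + f * euler g"
proof (rule mfps_eqI)
  fix N :: "'v \<Rightarrow> nat"
  have "of_nat (total_degree N) * (mfps_nth f A * mfps_nth g (N - A))
      = of_nat (total_degree A) * mfps_nth f A * mfps_nth g (N - A)
        + mfps_nth f A * (of_nat (total_degree (N - A)) * mfps_nth g (N - A))" if "A \<in> {..N}" for A
  proof -
    have "of_nat (total_degree N) = (of_nat (total_degree A) + of_nat (total_degree (N - A)) :: 'a)"
      using total_degree_split[of A N] that by simp
    then show ?thesis
      by (simp add: distrib_right mult.assoc mult_of_nat_commute)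
  qed
  then show "mfps_nth (euler (f * g)) N = mfps_nth (euler f * g + f * euler g) N"
    by (simp add: mfps_nth_mult sum_distrib_left sum.distrib[symmetric])
qed

lemma euler_power_Suc:
  fixes f :: "('v::finite, 'a::comm_ring_1) mfps"
  shows "euler (f ^ Suc n) = of_nat (Suc n) * (f ^ n * euler f)"
  by (induction n) (simp_all add: euler_mult algebra_simps)

lemma no_constant_term_euler: "no_constant_term (euler f)"
  by (simp add: no_constant_term_def)

lemma mfps_nth_mult_cong:
  fixes f f' :: "('v::finite, 'a::ring_1) mfps"
  assumes "\<And>A. A \<le> N \<Longrightarrow> mfps_nth f A = mfps_nth f' A"
  shows "mfps_nth (f * g) N = mfps_nth (f' * g) N"
  unfolding mfps_nth_mult using assms by (intro sum.cong) auto

text \<open>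
  The chain rule, with the termwise derivative of the one-variable series.
\<close>

lemma euler_power_series:
  fixes f :: "('v::finite, 'a::{rat_algebra_1,comm_ring_1}) mfps"
  assumes f: "no_constant_term f"
  shows "euler (mfps_power_series a f) = mfps_power_series (\<lambda>n. of_nat (Suc n) * a (Suc n)) f * euler f"
    (is "_ = mfps_power_series ?b f * _")
proof (rule mfps_eqI)
  fix N :: "'v \<Rightarrow> nat"
  define d where "d = total_degree N"
  have "mfps_nth (euler (mfps_power_series a f)) N = mfps_nth (euler (\<Sum>n\<le>Suc d. a n *\<^sub>Q f ^ n)) N"
    using mfps_nth_power_series[OF f, of N "Suc d" a] by (simp add: d_def)
  also have "euler (\<Sum>n\<le>Suc d. a n *\<^sub>Q f ^ n) = (\<Sum>n\<le>d. a (Suc n) *\<^sub>Q euler (f ^ Suc n))"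
    unfolding euler_sum euler_scaleQ by (subst sum.atMost_Suc_shift) simp
  also have "\<dots> = (\<Sum>n\<le>d. ?b n *\<^sub>Q f ^ n) * euler f"
    unfolding euler_power_Suc sum_distrib_right
    by (intro sum.cong refl)
      (simp add: mult_scaleQ_left mult_scaleQ_right scaleQ_scaleQ mult.commute flip: scaleQ_of_nat del: of_nat_Suc)
  also have "mfps_nth \<dots> N = mfps_nth (mfps_power_series ?b f * euler f) N"
  proof (rule mfps_nth_mult_cong)
    fix A assume "A \<le> N"
    then have "total_degree A \<le> d" using total_degree_split[of A N] by (simp add: d_def)
    then show "mfps_nth (\<Sum>n\<le>d. ?b n *\<^sub>Q f ^ n) A = mfps_nth (mfps_power_series ?b f) A"
      using mfps_nth_power_series[OF f] by metis
  qed
  finally show "mfps_nth (euler (mfps_power_series a f)) N = mfps_nth (mfps_power_series ?b f * euler f) N" .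
qed

text \<open>
  If \<open>f\<close> vanishes below degree \<open>k\<close>, then \<open>f h\<close> vanishes below degree \<open>k + 1\<close>, and so does \<open>f\<close>
  because the Euler derivation multiplies degree \<open>n\<close> by \<open>n\<close>.
\<close>

lemma euler_ode_unique:
  fixes f :: "('v::finite, 'a::rat_algebra_1) mfps"
  assumes "euler f = f * h" "no_constant_term h" "mfps_nth f (\<lambda>_. 0) = 0"
  shows "f = 0"
proof (rule vanishes_below_all_imp_0)
  fix k
  show "vanishes_below k f"
  proof (induction k)
    case 0
    show ?case by (simp add: vanishes_below_def)
  next
    case (Suc k)
    have van: "vanishes_below (Suc k) (euler f)"
      using vanishes_below_mult[of k f "Suc 0" h] Suc assms(1,2)
      by (simp add: vanishes_below_Suc_0_iff)
    show ?case
    proof (rule vanishes_belowI)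
      fix N :: "'v \<Rightarrow> nat" assume N: "total_degree N < Suc k"
      show "mfps_nth f N = 0"
      proof (cases "total_degree N = 0")
        case True
        then show ?thesis using assms(3) by (simp add: total_degree_eq_0_iff)
      next
        case False
        have "of_nat (total_degree N) * mfps_nth f N = 0" using vanishes_belowD[OF van N] by simp
        with False show ?thesis using of_nat_mult_eq_0 by blast
      qed
    qed
  qed
qed

lemma euler_exp:
  fixes f :: "('v::finite, 'a::{rat_algebra_1,comm_ring_1}) mfps"
  assumes "no_constant_term f"
  shows "euler (mfps_exp f) = mfps_exp f * euler f"
proof -
  have "(\<lambda>n. of_nat (Suc n) * exp_coeff (Suc n)) = exp_coeff"
    by (simp add: exp_coeff_def fun_eq_iff del: of_nat_Suc)
  then show ?thesis
    using euler_power_series[OF assms, of exp_coeff] by (simp add: mfps_exp_conv_power_series assms)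
qed

lemma mfps_nth_exp_zero: "no_constant_term f \<Longrightarrow> mfps_nth (mfps_exp f) (\<lambda>_. 0) = 1"
  by (simp add: mfps_exp_conv_power_series mfps_nth_power_series_zero exp_coeff_def scaleQ_one)

text \<open>
  Both sides solve \<open>euler y = y * euler (f + g)\<close> with constant term 1.
\<close>

lemma mfps_exp_add:
  fixes f g :: "('v::finite, 'a::{rat_algebra_1,comm_ring_1}) mfps"
  assumes f: "no_constant_term f" and g: "no_constant_term g"
  shows "mfps_exp (f + g) = mfps_exp f * mfps_exp g"
proof -
  note fg = no_constant_term_add[OF f g]
  have "mfps_exp (f + g) - mfps_exp f * mfps_exp g = 0"
  proof (rule euler_ode_unique)
    show "euler (mfps_exp (f + g) - mfps_exp f * mfps_exp g)
        = (mfps_exp (f + g) - mfps_exp f * mfps_exp g) * euler (f + g)"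
      by (simp add: euler_diff euler_mult euler_add euler_exp f g fg algebra_simps)
    show "no_constant_term (euler (f + g))" by (rule no_constant_term_euler)
    show "mfps_nth (mfps_exp (f + g) - mfps_exp f * mfps_exp g) (\<lambda>_. 0) = 0"
      using mfps_nth_exp_zero[OF f] mfps_nth_exp_zero[OF g] mfps_nth_exp_zero[OF fg]
      by (simp add: mfps_nth_mult_zero)
  qed
  then show ?thesis by simp
qed

lemma mfps_geometric_inverse:
  fixes f :: "('v::finite, 'a::{rat_algebra_1,comm_ring_1}) mfps"
  assumes f: "no_constant_term f"
  shows "mfps_power_series (\<lambda>n. (- 1) ^ n) f * (1 + f) = 1"
proof (rule mfps_eqI)
  fix N :: "'v \<Rightarrow> nat"
  define d where "d = total_degree N"
  have "mfps_nth (mfps_power_series (\<lambda>n. (- 1) ^ n) f * (1 + f)) N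
      = mfps_nth ((\<Sum>n\<le>d. (- 1) ^ n *\<^sub>Q f ^ n) * (1 + f)) N"
  proof (rule mfps_nth_mult_cong)
    fix A assume "A \<le> N"
    then have "total_degree A \<le> d" using total_degree_split[of A N] by (simp add: d_def)
    then show "mfps_nth (mfps_power_series (\<lambda>n. (- 1) ^ n) f) A = mfps_nth (\<Sum>n\<le>d. (- 1) ^ n *\<^sub>Q f ^ n) A"
      by (rule mfps_nth_power_series[OF f])
  qed
  also have "(\<Sum>n\<le>d. (- 1) ^ n *\<^sub>Q f ^ n) * (1 + f) = 1 + (- 1) ^ d *\<^sub>Q f ^ Suc d"
    by (induction d)
      (simp_all add: scaleQ_one algebra_simps mult_scaleQ_left mult_scaleQ_right scaleQ_minus_left scaleQ_add_right)
  also have "mfps_nth \<dots> N = mfps_nth 1 N"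
    using mfps_nth_power_eq_0[OF f, of N "Suc d"] by (simp add: d_def)
  finally show "mfps_nth (mfps_power_series (\<lambda>n. (- 1) ^ n) f * (1 + f)) N = mfps_nth 1 N" .
qed

lemma euler_log:
  fixes f :: "('v::finite, 'a::{rat_algebra_1,comm_ring_1}) mfps"
  assumes f: "no_constant_term f"
  shows "euler (mfps_log (1 + f)) * (1 + f) = euler f"
proof -
  have "(\<lambda>n. of_nat (Suc n) * log_coeff (Suc n)) = (\<lambda>n. (- 1) ^ n)"
    by (simp add: log_coeff_def fun_eq_iff del: of_nat_Suc)
  then have "euler (mfps_log (1 + f)) = mfps_power_series (\<lambda>n. (- 1) ^ n) f * euler f"
    using euler_power_series[OF f, of log_coeff] by (simp add: mfps_log_conv_power_series f)
  then have "euler (mfps_log (1 + f)) * (1 + f)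
      = (mfps_power_series (\<lambda>n. (- 1) ^ n) f * (1 + f)) * euler f"
    by (simp only: mult_ac)
  then show ?thesis by (simp add: mfps_geometric_inverse[OF f])
qed

lemma mfps_nth_log_zero: "no_constant_term f \<Longrightarrow> mfps_nth (mfps_log (1 + f)) (\<lambda>_. 0) = 0"
  by (simp add: mfps_log_conv_power_series mfps_nth_power_series_zero log_coeff_def)

lemma no_constant_term_log: "no_constant_term f \<Longrightarrow> no_constant_term (mfps_log (1 + f))"
  by (simp add: no_constant_term_def[of "mfps_log _"] mfps_nth_log_zero)

text \<open>
  The logarithmic derivatives agree, so the difference of the two sides is a constant; its constant
  term is 0.
\<close>

lemma mfps_log_mult:
  fixes f g h :: "('v::finite, 'a::{rat_algebra_1,comm_ring_1}) mfps"
  assumes f: "no_constant_term f" and g: "no_constant_term g" and h: "1 + h = (1 + f) * (1 + g)"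
  shows "mfps_log (1 + h) = mfps_log (1 + f) + mfps_log (1 + g)"
proof -
  have h': "h = f + g + f * g" using h by (simp add: algebra_simps)
  have vh: "no_constant_term h"
    unfolding h' by (intro no_constant_term_add f g no_constant_term_mult_left)
  define D where "D = mfps_log (1 + h) - (mfps_log (1 + f) + mfps_log (1 + g))"
  have "euler D * (1 + h)
      = euler (mfps_log (1 + h)) * (1 + h) - euler (mfps_log (1 + f)) * (1 + f) * (1 + g)
        - euler (mfps_log (1 + g)) * (1 + g) * (1 + f)"
    unfolding D_def euler_diff euler_add h by (simp add: algebra_simps)
  also have "\<dots> = 0"
    unfolding euler_log[OF vh] euler_log[OF f] euler_log[OF g]
    by (simp add: h' euler_add euler_mult algebra_simps)
  finally have "euler D * (1 + h) = 0" .
  then have "mfps_power_series (\<lambda>n. (- 1) ^ n) h * (1 + h) * euler D = 0"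
    by (metis mult.assoc mult.commute mult_zero_right)
  then have "euler D = 0" by (simp add: mfps_geometric_inverse[OF vh])
  then have "D = 0"
    by (intro euler_ode_unique[of D 0])
      (simp_all add: D_def mfps_nth_log_zero[OF f] mfps_nth_log_zero[OF g] mfps_nth_log_zero[OF vh]
        no_constant_term_def)
  then show ?thesis by (simp add: D_def)
qed

section \<open>Substitution of integral power series\<close>

definition mfps_prod_power :: "('v::finite \<Rightarrow> ('w::finite, int) mfps) \<Rightarrow> ('v \<Rightarrow> nat) \<Rightarrow> ('w, int) mfps"
  where "mfps_prod_power z N = (\<Prod>v\<in>UNIV. z v ^ N v)"

lemma mfps_prod_power_add:
  "mfps_prod_power z (\<lambda>v. M v + N v) = mfps_prod_power z M * mfps_prod_power z N"
  by (simp add: mfps_prod_power_def power_add prod.distrib)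

lemma mfps_prod_power_zero [simp]: "mfps_prod_power z (\<lambda>_. 0) = 1"
  by (simp add: mfps_prod_power_def)

lemma mfps_prod_power_single: "mfps_prod_power z (\<lambda>w. if w = v then 1 else 0) = z v"
proof -
  have "mfps_prod_power z (\<lambda>w. if w = v then 1 else 0) = (\<Prod>w\<in>UNIV. if w = v then z v else 1)"
    unfolding mfps_prod_power_def by (intro prod.cong) auto
  then show ?thesis by simp
qed

lemma vanishes_below_prod:
  fixes f :: "'i \<Rightarrow> ('v::finite, 'a::comm_ring_1) mfps"
  assumes "\<And>i. i \<in> S \<Longrightarrow> vanishes_below (k i) (f i)"
  shows "vanishes_below (\<Sum>i\<in>S. k i) (\<Prod>i\<in>S. f i)"
  using assms
  by (induction S rule: infinite_finite_induct)
    (simp_all add: vanishes_below_mult, simp_all add: vanishes_below_def)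

lemma mfps_nth_prod_power_eq_0:
  assumes "\<And>v. no_constant_term (z v)" "total_degree L < total_degree N"
  shows "mfps_nth (mfps_prod_power z N) L = 0"
proof -
  have "vanishes_below (total_degree N) (mfps_prod_power z N)"
    unfolding mfps_prod_power_def total_degree_def
    by (intro vanishes_below_prod vanishes_below_power assms)
  then show ?thesis using assms(2) by (rule vanishes_belowD)
qed

text \<open>
  The substitution \<open>x\<^sub>v \<mapsto> z\<^sub>v\<close>, for series \<open>z\<^sub>v\<close> without constant term; these have integer
  coefficients, so that each coefficient of the result is an integral combination of coefficients
  of \<open>f\<close>. Only the monomials of degree at most \<open>total_degree L\<close> can contribute to the
  coefficient at \<open>L\<close>.
\<close>

definition mfps_subst ::
    "('v::finite \<Rightarrow> ('w::finite, int) mfps) \<Rightarrow> ('v, 'a::rat_algebra_1) mfps \<Rightarrow> ('w, 'a) mfps"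
  where "mfps_subst z f = Abs_mfps (\<lambda>L.
    \<Sum>N | total_degree N \<le> total_degree L. of_int (mfps_nth (mfps_prod_power z N) L) *\<^sub>Q mfps_nth f N)"

lemma mfps_nth_subst:
  assumes "\<And>v. no_constant_term (z v)" "total_degree L \<le> d"
  shows "mfps_nth (mfps_subst z f) L
    = (\<Sum>N | total_degree N \<le> d. of_int (mfps_nth (mfps_prod_power z N) L) *\<^sub>Q mfps_nth f N)"
proof -
  have "of_int (mfps_nth (mfps_prod_power z N) L) *\<^sub>Q mfps_nth f N = 0" if "\<not> total_degree N \<le> total_degree L" for N
    using that mfps_nth_prod_power_eq_0[OF assms(1), of L N] by simp
  then show ?thesis
    unfolding mfps_subst_def mfps_nth_Abs using assms(2)
    by (intro sum.mono_neutral_left) (auto simp: finite_total_degree_le)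
qed

lemma mfps_subst_add: "mfps_subst z (f + g) = mfps_subst z f + mfps_subst z g"
  by (rule mfps_eqI) (simp add: mfps_subst_def scaleQ_add_right sum.distrib)

lemma mfps_subst_scaleQ: "mfps_subst z (q *\<^sub>Q f) = q *\<^sub>Q mfps_subst z f"
  by (rule mfps_eqI) (simp add: mfps_subst_def scaleQ_sum_right scaleQ_scaleQ mult.commute)

lemma mfps_subst_sum:
  fixes f :: "'i \<Rightarrow> ('v::finite, 'a::rat_algebra_1) mfps" and z :: "'v \<Rightarrow> ('w::finite, int) mfps"
  shows "mfps_subst z (\<Sum>i\<in>S. f i) = (\<Sum>i\<in>S. mfps_subst z (f i))"
proof -
  have "mfps_subst z 0 = (0 :: ('w, 'a) mfps)"
    by (rule mfps_eqI) (simp add: mfps_subst_def)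
  then show ?thesis
    by (induction S rule: infinite_finite_induct) (simp_all add: mfps_subst_add)
qed

lemma mfps_subst_one [simp]:
  fixes z :: "'v::finite \<Rightarrow> ('w::finite, int) mfps"
  shows "mfps_subst z 1 = (1 :: ('w::finite, 'a::rat_algebra_1) mfps)"
proof (rule mfps_eqI)
  fix L :: "'w \<Rightarrow> nat"
  have "mfps_nth (mfps_subst z 1) L
      = (\<Sum>N | total_degree (N :: 'v \<Rightarrow> nat) \<le> total_degree L. if N = (\<lambda>_. 0) then mfps_nth 1 L else (0::'a))"
    unfolding mfps_subst_def mfps_nth_Abs
    by (intro sum.cong refl) (auto simp: mfps_nth_one scaleQ_one)
  then show "mfps_nth (mfps_subst z 1) L = (mfps_nth 1 L :: 'a)"
    by (simp add: sum.delta finite_total_degree_le)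
qed

text \<open>
  Both sides are sums over pairs of monomials \<open>M\<close>, \<open>N\<close> of the coefficients of \<open>z\<^bsup>M + N\<^esup>\<close>. On the right
  \<open>M\<close> and \<open>N\<close> have degree at most \<open>d\<close>, on the left \<open>M + N\<close> has; the additional pairs on the right
  contribute 0.
\<close>

lemma mfps_subst_mult:
  fixes f g :: "('v::finite, 'a::rat_algebra_1) mfps" and z :: "'v \<Rightarrow> ('w::finite, int) mfps"
  assumes z: "\<And>v. no_constant_term (z v)"
  shows "mfps_subst z (f * g) = mfps_subst z f * mfps_subst z g"
proof (rule mfps_eqI)
  fix L :: "'w \<Rightarrow> nat"
  define d where "d = total_degree L"
  define D where "D = {N :: 'v \<Rightarrow> nat. total_degree N \<le> d}"
  define c where "c N A = (of_int (mfps_nth (mfps_prod_power z N) A) :: rat)" for N A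
  have finD: "finite D" by (simp add: D_def finite_total_degree_le)
  have c_add: "c (\<lambda>v. M v + N v) L = (\<Sum>A\<in>{..L}. c M A * c N (L - A))" for M N
    by (simp add: c_def mfps_prod_power_add mfps_nth_mult)
  have "mfps_nth (mfps_subst z f * mfps_subst z g) L
      = (\<Sum>A\<in>{..L}. (\<Sum>M\<in>D. c M A *\<^sub>Q mfps_nth f M) * (\<Sum>N\<in>D. c N (L - A) *\<^sub>Q mfps_nth g N))"
    unfolding mfps_nth_mult
  proof (intro sum.cong refl)
    fix A assume "A \<in> {..L}"
    then have "total_degree A \<le> d" "total_degree (L - A) \<le> d"
      using total_degree_split[of A L] by (simp_all add: d_def)
    then show "mfps_nth (mfps_subst z f) A * mfps_nth (mfps_subst z g) (L - A)
        = (\<Sum>M\<in>D. c M A *\<^sub>Q mfps_nth f M) * (\<Sum>N\<in>D. c N (L - A) *\<^sub>Q mfps_nth g N)"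
      by (simp add: mfps_nth_subst[OF z] c_def D_def)
  qed
  also have "\<dots> = (\<Sum>A\<in>{..L}. \<Sum>M\<in>D. \<Sum>N\<in>D. (c M A * c N (L - A)) *\<^sub>Q (mfps_nth f M * mfps_nth g N))"
    by (simp add: sum_product scaleQ_mult_scaleQ)
  also have "\<dots> = (\<Sum>M\<in>D. \<Sum>A\<in>{..L}. \<Sum>N\<in>D. (c M A * c N (L - A)) *\<^sub>Q (mfps_nth f M * mfps_nth g N))"
    by (rule sum.swap)
  also have "\<dots> = (\<Sum>M\<in>D. \<Sum>N\<in>D. \<Sum>A\<in>{..L}. (c M A * c N (L - A)) *\<^sub>Q (mfps_nth f M * mfps_nth g N))"
    by (rule sum.cong[OF refl], rule sum.swap)
  also have "\<dots> = (\<Sum>M\<in>D. \<Sum>N\<in>D. c (\<lambda>v. M v + N v) L *\<^sub>Q (mfps_nth f M * mfps_nth g N))"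
    by (simp add: c_add scaleQ_sum_left)
  also have "\<dots> = (\<Sum>(M, N)\<in>D \<times> D. c (\<lambda>v. M v + N v) L *\<^sub>Q (mfps_nth f M * mfps_nth g N))"
    by (rule sum.cartesian_product)
  also have "\<dots> = (\<Sum>(M, N) | (M, N) \<in> D \<times> D \<and> (\<lambda>v. M v + N v) \<in> D.
      c (\<lambda>v. M v + N v) L *\<^sub>Q (mfps_nth f M * mfps_nth g N))"
  proof (rule sum.mono_neutral_right)
    have c0: "c N L = 0" if "N \<notin> D" for N
      using that mfps_nth_prod_power_eq_0[OF z, of L N] by (simp add: D_def d_def c_def)
    show "\<forall>i\<in>D \<times> D - {(M, N). (M, N) \<in> D \<times> D \<and> (\<lambda>v. M v + N v) \<in> D}.
      (case i of (M, N) \<Rightarrow> c (\<lambda>v. M v + N v) L *\<^sub>Q (mfps_nth f M * mfps_nth g N)) = 0"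
      by (clarsimp, rule ccontr, simp add: c0)
  qed (use finD in auto)
  also have "\<dots> = (\<Sum>(N, A)\<in>Sigma D (\<lambda>N. {..N}). c N L *\<^sub>Q (mfps_nth f A * mfps_nth g (N - A)))"
  proof (rule sum.reindex_bij_witness[of _ "\<lambda>(N, A). (A, N - A)" "\<lambda>(M, N). (\<lambda>v. M v + N v, M)"])
    fix x assume "x \<in> {(M, N). (M, N) \<in> D \<times> D \<and> (\<lambda>v. M v + N v) \<in> D}"
    then obtain M N where x: "x = (M, N)" and MN: "(\<lambda>v. M v + N v) \<in> D" by auto
    have *: "(\<lambda>v. M v + N v) - M = N" by (simp add: fun_eq_iff)
    show "(case case x of (M, N) \<Rightarrow> (\<lambda>v. M v + N v, M) of (N, A) \<Rightarrow> (A, N - A)) = x"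
      by (simp add: x *)
    show "(case x of (M, N) \<Rightarrow> (\<lambda>v. M v + N v, M)) \<in> Sigma D (\<lambda>N. {..N})"
      using MN by (simp add: x le_fun_def)
    show "(case case x of (M, N) \<Rightarrow> (\<lambda>v. M v + N v, M) of
          (N, A) \<Rightarrow> c N L *\<^sub>Q (mfps_nth f A * mfps_nth g (N - A)))
        = (case x of (M, N) \<Rightarrow> c (\<lambda>v. M v + N v) L *\<^sub>Q (mfps_nth f M * mfps_nth g N))"
      by (simp add: x *)
  next
    fix y assume "y \<in> Sigma D (\<lambda>N. {..N})"
    then obtain N A where y: "y = (N, A)" and N: "N \<in> D" and A: "A \<le> N" by auto
    have *: "(\<lambda>v. A v + (N - A) v) = N" using A by (simp add: fun_eq_iff le_fun_def)
    show "(case case y of (N, A) \<Rightarrow> (A, N - A) of (M, N) \<Rightarrow> (\<lambda>v. M v + N v, M)) = y"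
      using * by (simp add: y)
    show "(case y of (N, A) \<Rightarrow> (A, N - A)) \<in> {(M, N). (M, N) \<in> D \<times> D \<and> (\<lambda>v. M v + N v) \<in> D}"
      using N A * total_degree_split[OF A] by (simp add: y D_def)
  qed
  also have "\<dots> = (\<Sum>N\<in>D. \<Sum>A\<in>{..N}. c N L *\<^sub>Q (mfps_nth f A * mfps_nth g (N - A)))"
    by (simp add: sum.Sigma finD finite_atMost_fun_nat)
  also have "\<dots> = mfps_nth (mfps_subst z (f * g)) L"
    by (simp add: mfps_subst_def c_def D_def d_def mfps_nth_mult scaleQ_sum_right)
  finally show "mfps_nth (mfps_subst z (f * g)) L = mfps_nth (mfps_subst z f * mfps_subst z g) L"
    by simp
qed

lemma mfps_subst_power:
  "(\<And>v. no_constant_term (z v)) \<Longrightarrow> mfps_subst z (f ^ n) = mfps_subst z f ^ n"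
  by (induction n) (simp_all add: mfps_subst_mult)

lemma no_constant_term_subst:
  fixes f :: "('v::finite, 'a::rat_algebra_1) mfps"
  assumes "no_constant_term f"
  shows "no_constant_term (mfps_subst z f)"
  using assms by (simp add: no_constant_term_def mfps_subst_def total_degree_eq_0_iff)

lemma mfps_subst_power_series:
  fixes f :: "('v::finite, 'a::rat_algebra_1) mfps" and z :: "'v \<Rightarrow> ('w::finite, int) mfps"
  assumes z: "\<And>v. no_constant_term (z v)" and f: "no_constant_term f"
  shows "mfps_subst z (mfps_power_series a f) = mfps_power_series a (mfps_subst z f)"
proof (rule mfps_eqI)
  fix L :: "'w \<Rightarrow> nat"
  define d where "d = total_degree L"
  have "mfps_nth (mfps_subst z (mfps_power_series a f)) L
      = mfps_nth (mfps_subst z (\<Sum>n\<le>d. a n *\<^sub>Q f ^ n)) L"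
    unfolding mfps_subst_def mfps_nth_Abs d_def
    by (intro sum.cong refl arg_cong2[where f = scaleQ] mfps_nth_power_series f) auto
  also have "\<dots> = mfps_nth (\<Sum>n\<le>d. a n *\<^sub>Q mfps_subst z f ^ n) L"
    by (simp only: mfps_subst_sum mfps_subst_scaleQ mfps_subst_power[OF z])
  also have "\<dots> = mfps_nth (mfps_power_series a (mfps_subst z f)) L"
    by (rule mfps_nth_power_series[symmetric]) (simp_all add: no_constant_term_subst f d_def)
  finally show "mfps_nth (mfps_subst z (mfps_power_series a f)) L
      = mfps_nth (mfps_power_series a (mfps_subst z f)) L" .
qed

lemma T_series_add: "T_series (f + g) = T_series f + T_series g"
  by (rule mfps_eqI) (simp add: T_series_def uea_gen_add)

lemma no_constant_term_T_series: "no_constant_term f \<Longrightarrow> no_constant_term (T_series f)"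
  by (simp add: no_constant_term_def T_series_def)

lemma mfps_subst_T_series: "mfps_subst z (T_series f) = T_series (mfps_subst z f)"
  by (rule mfps_eqI) (simp add: T_series_def mfps_subst_def uea_gen_sum uea_gen_scaleQ)

text \<open>
  The coefficients that span the ring are those of \<open>exp_T_log\<close> at the generic element
  \<open>\<Sum>\<^sub>c c x\<^sub>c\<close>. As a function of \<open>1 + f\<close> it is a homomorphism from the multiplicative group of
  series with constant term 1 to the units of the series over the enveloping algebra.
\<close>

definition exp_T_log :: "('v::finite, 'a::rat_algebra_1) mfps \<Rightarrow> ('v, 'a uea) mfps"
  where "exp_T_log f = mfps_exp (T_series (mfps_log (1 + f)))"

lemma no_constant_term_T_log:
  fixes f :: "('v::finite, 'a::{rat_algebra_1,comm_ring_1}) mfps"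
  shows "no_constant_term f \<Longrightarrow> no_constant_term (T_series (mfps_log (1 + f)))"
  by (intro no_constant_term_T_series no_constant_term_log)

lemma exp_T_log_mult:
  fixes f g h :: "('v::finite, 'a::{rat_algebra_1,comm_ring_1}) mfps"
  assumes "no_constant_term f" "no_constant_term g" "1 + h = (1 + f) * (1 + g)"
  shows "exp_T_log h = exp_T_log f * exp_T_log g"
  unfolding exp_T_log_def mfps_log_mult[OF assms] T_series_add
  by (intro mfps_exp_add no_constant_term_T_log assms)

lemma mfps_subst_exp_T_log:
  fixes f :: "('v::finite, 'a::{rat_algebra_1,comm_ring_1}) mfps"
  assumes z: "\<And>v. no_constant_term (z v)" and f: "no_constant_term f"
  shows "mfps_subst z (exp_T_log f) = exp_T_log (mfps_subst z f)"
proof -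
  have "mfps_subst z (mfps_log (1 + f)) = mfps_log (1 + mfps_subst z f)"
    by (simp add: mfps_log_conv_power_series f no_constant_term_subst mfps_subst_power_series z)
  moreover have "mfps_subst z (mfps_exp (T_series (mfps_log (1 + f))))
      = mfps_exp (mfps_subst z (T_series (mfps_log (1 + f))))"
    by (simp add: mfps_exp_conv_power_series f no_constant_term_T_log no_constant_term_subst mfps_subst_power_series z)
  ultimately show ?thesis by (simp add: exp_T_log_def mfps_subst_T_series)
qed

section \<open>Linear forms with series as coefficients\<close>

lemma mfps_nth_monom: "mfps_nth (mfps_monom a v) N = (if N = (\<lambda>w. if w = v then 1 else 0) then a else 0)"
  by (simp add: mfps_monom.rep_eq)

lemma no_constant_term_monom: "no_constant_term (mfps_monom a v)"
  by (auto simp: no_constant_term_def mfps_nth_monom fun_eq_iff)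

lemma no_constant_term_sum:
  fixes f :: "'i \<Rightarrow> ('v::finite, 'a::ring_1) mfps"
  shows "(\<And>i. i \<in> S \<Longrightarrow> no_constant_term (f i)) \<Longrightarrow> no_constant_term (\<Sum>i\<in>S. f i)"
  by (simp add: no_constant_term_def)

definition lincomb :: "('v::finite \<Rightarrow> 'a::rat_algebra_1) \<Rightarrow> ('v \<Rightarrow> ('w, int) mfps) \<Rightarrow> ('w, 'a) mfps"
  where "lincomb s z = Abs_mfps (\<lambda>L. \<Sum>v\<in>UNIV. of_int (mfps_nth (z v) L) *\<^sub>Q s v)"

lemma mfps_subst_monom:
  fixes z :: "'v::finite \<Rightarrow> ('w::finite, int) mfps" and a :: "'a::rat_algebra_1"
  assumes z: "\<And>v. no_constant_term (z v)"
  shows "mfps_nth (mfps_subst z (mfps_monom a v)) L = of_int (mfps_nth (z v) L) *\<^sub>Q a"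
proof -
  let ?e = "\<lambda>w. if w = v then 1 else (0::nat)"
  have e: "total_degree ?e \<le> total_degree L + 1" by (simp add: total_degree_def)
  have "mfps_nth (mfps_subst z (mfps_monom a v)) L
      = (\<Sum>N | total_degree N \<le> total_degree L + 1. of_int (mfps_nth (mfps_prod_power z N) L) *\<^sub>Q mfps_nth (mfps_monom a v) N)"
    by (rule mfps_nth_subst[OF z]) simp
  also have "\<dots> = (\<Sum>N | total_degree N \<le> total_degree L + 1. if N = ?e then of_int (mfps_nth (z v) L) *\<^sub>Q a else 0)"
  proof (rule sum.cong[OF refl])
    fix N
    show "of_int (mfps_nth (mfps_prod_power z N) L) *\<^sub>Q mfps_nth (mfps_monom a v) N
      = (if N = ?e then of_int (mfps_nth (z v) L) *\<^sub>Q a else 0)"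
      using mfps_prod_power_single[of z v] by (auto simp: mfps_nth_monom)
  qed
  also have "\<dots> = of_int (mfps_nth (z v) L) *\<^sub>Q a"
    using e by (simp add: sum.delta finite_total_degree_le)
  finally show ?thesis .
qed

lemma mfps_subst_generic:
  assumes "\<And>v. no_constant_term (z v)"
  shows "mfps_subst z (\<Sum>v\<in>UNIV. mfps_monom (s v) v) = lincomb s z"
  by (rule mfps_eqI) (simp add: mfps_subst_sum mfps_subst_monom assms lincomb_def)

lemma lincomb_add: "lincomb s (\<lambda>v. y v + z v) = lincomb s y + lincomb s z"
  by (rule mfps_eqI) (simp add: lincomb_def scaleQ_add_left sum.distrib)

lemma no_constant_term_lincomb: "(\<And>v. no_constant_term (z v)) \<Longrightarrow> no_constant_term (lincomb s z)"
  by (simp add: no_constant_term_def lincomb_def)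

text \<open>
  The coordinates of a product of two linear forms, if \<open>n a b v\<close> is the coefficient of \<open>s v\<close> in
  \<open>s a * s b\<close>.
\<close>

definition structure_mult ::
    "('v::finite \<Rightarrow> 'v \<Rightarrow> 'v \<Rightarrow> int) \<Rightarrow> ('v \<Rightarrow> ('w::finite, int) mfps) \<Rightarrow> ('v \<Rightarrow> ('w, int) mfps) \<Rightarrow> 'v \<Rightarrow> ('w, int) mfps"
  where "structure_mult n y z v = (\<Sum>a\<in>UNIV. \<Sum>b\<in>UNIV. of_int (n a b v) * (y a * z b))"

lemma mfps_nth_of_int_mult: "mfps_nth (of_int k * f) N = of_int k * mfps_nth (f :: ('v::finite, 'a::ring_1) mfps) N"
proof -
  have "mfps_nth (of_nat k * f) N = of_nat k * mfps_nth f N" for k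
    by (induction k) (simp_all add: distrib_right)
  then show ?thesis by (cases k rule: int_cases2) simp_all
qed

lemma lincomb_mult:
  fixes s :: "'v::finite \<Rightarrow> 'a::rat_algebra_1" and y z :: "'v \<Rightarrow> ('w::finite, int) mfps"
  assumes "\<And>a b. s a * s b = (\<Sum>v\<in>UNIV. of_int (n a b v) *\<^sub>Q s v)"
  shows "lincomb s y * lincomb s z = lincomb s (structure_mult n y z)"
proof (rule mfps_eqI)
  fix L :: "'w \<Rightarrow> nat"
  have "mfps_nth (lincomb s y * lincomb s z) L
    = (\<Sum>A\<in>{..L}. \<Sum>a\<in>UNIV. \<Sum>b\<in>UNIV. of_int (mfps_nth (y a) A * mfps_nth (z b) (L - A)) *\<^sub>Q (s a * s b))"
    by (simp add: mfps_nth_mult lincomb_def sum_product scaleQ_mult_scaleQ)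
  also have "\<dots> = (\<Sum>a\<in>UNIV. \<Sum>A\<in>{..L}. \<Sum>b\<in>UNIV. of_int (mfps_nth (y a) A * mfps_nth (z b) (L - A)) *\<^sub>Q (s a * s b))"
    by (rule sum.swap)
  also have "\<dots> = (\<Sum>a\<in>UNIV. \<Sum>b\<in>UNIV. \<Sum>A\<in>{..L}. of_int (mfps_nth (y a) A * mfps_nth (z b) (L - A)) *\<^sub>Q (s a * s b))"
    by (rule sum.cong[OF refl], rule sum.swap)
  also have "\<dots> = (\<Sum>a\<in>UNIV. \<Sum>b\<in>UNIV. of_int (mfps_nth (y a * z b) L) *\<^sub>Q (s a * s b))"
    by (simp add: mfps_nth_mult scaleQ_sum_left)
  also have "\<dots> = (\<Sum>a\<in>UNIV. \<Sum>b\<in>UNIV. \<Sum>v\<in>UNIV. of_int (n a b v * mfps_nth (y a * z b) L) *\<^sub>Q s v)"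
    by (simp add: assms scaleQ_sum_right scaleQ_scaleQ mult.commute)
  also have "\<dots> = (\<Sum>a\<in>UNIV. \<Sum>v\<in>UNIV. \<Sum>b\<in>UNIV. of_int (n a b v * mfps_nth (y a * z b) L) *\<^sub>Q s v)"
    by (rule sum.cong[OF refl], rule sum.swap)
  also have "\<dots> = (\<Sum>v\<in>UNIV. \<Sum>a\<in>UNIV. \<Sum>b\<in>UNIV. of_int (n a b v * mfps_nth (y a * z b) L) *\<^sub>Q s v)"
    by (rule sum.swap)
  also have "\<dots> = mfps_nth (lincomb s (structure_mult n y z)) L"
    by (simp add: lincomb_def structure_mult_def mfps_nth_of_int_mult scaleQ_sum_left del: of_int_mult)
  finally show "mfps_nth (lincomb s y * lincomb s z) L = mfps_nth (lincomb s (structure_mult n y z)) L" .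
qed

lemma no_constant_term_structure_mult:
  "(\<And>v. no_constant_term (y v)) \<Longrightarrow> no_constant_term (structure_mult n y z v)"
  by (simp add: no_constant_term_def structure_mult_def mfps_nth_of_int_mult mfps_nth_mult_zero)

section \<open>Separating two sets of variables\<close>

definition mfps_monomial :: "('w::finite \<Rightarrow> nat) \<Rightarrow> ('w, int) mfps"
  where "mfps_monomial L = Abs_mfps (\<lambda>A. if A = L then 1 else 0)"

lemma mfps_monomial_zero: "mfps_monomial (\<lambda>_. 0) = 1"
  by (rule mfps_eqI) (simp add: mfps_monomial_def mfps_nth_one)

lemma mfps_monomial_add: "mfps_monomial (\<lambda>w. K w + L w) = mfps_monomial K * mfps_monomial L"
proof (rule mfps_eqI)
  fix A :: "'a \<Rightarrow> nat"
  have "mfps_nth (mfps_monomial K * mfps_monomial L) A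
      = (\<Sum>B\<in>{..A}. if B = K then (if A - K = L then 1 else 0) else 0)"
    unfolding mfps_nth_mult by (intro sum.cong) (auto simp: mfps_monomial_def)
  also have "\<dots> = (if K \<le> A \<and> A - K = L then 1 else 0)"
    by (simp add: sum.delta finite_atMost_fun_nat)
  also have "K \<le> A \<and> A - K = L \<longleftrightarrow> A = (\<lambda>w. K w + L w)"
  proof -
    have "K w \<le> A w \<and> A w - K w = L w \<longleftrightarrow> A w = K w + L w" for w by auto
    then show ?thesis by (simp add: le_fun_def fun_eq_iff flip: all_conj_distrib)
  qed
  finally show "mfps_nth (mfps_monomial (\<lambda>w. K w + L w)) A = mfps_nth (mfps_monomial K * mfps_monomial L) A"
    by (simp add: mfps_monomial_def)
qed

lemma mfps_monomial_power: "mfps_monomial L ^ n = mfps_monomial (\<lambda>w. n * L w)"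
  by (induction n) (simp_all add: mfps_monomial_zero mfps_monomial_add)

lemma mfps_monomial_prod: "(\<Prod>i\<in>S. mfps_monomial (L i)) = mfps_monomial (\<lambda>w. \<Sum>i\<in>S. L i w)"
  by (induction S rule: infinite_finite_induct) (simp_all add: mfps_monomial_zero mfps_monomial_add)

lemma mfps_monom_conv_monomial: "mfps_monom 1 v = mfps_monomial (\<lambda>w. if w = v then 1 else 0)"
  by (rule mfps_eqI) (simp add: mfps_nth_monom mfps_monomial_def)

lemma mfps_prod_power_monom:
  "mfps_prod_power (\<lambda>v. mfps_monom 1 (h v)) N = mfps_monomial (\<lambda>w. \<Sum>v\<in>UNIV. if w = h v then N v else 0)"
  by (simp add: mfps_prod_power_def mfps_monom_conv_monomial mfps_monomial_power mfps_monomial_prod if_distrib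
    cong: if_cong)

lemma mfps_prod_power_Inl:
  fixes N :: "'v::finite \<Rightarrow> nat"
  shows "mfps_prod_power (\<lambda>v. mfps_monom 1 (Inl v :: 'v + 'w::finite)) N = mfps_monomial (case_sum N (\<lambda>_. 0))"
proof -
  have "(\<lambda>w :: 'v + 'w. \<Sum>v\<in>UNIV. if w = Inl v then N v else 0) = case_sum N (\<lambda>_. 0)"
    by (auto simp: fun_eq_iff split: sum.splits)
  then show ?thesis by (simp add: mfps_prod_power_monom)
qed

lemma mfps_prod_power_Inr:
  fixes N :: "'v::finite \<Rightarrow> nat"
  shows "mfps_prod_power (\<lambda>v. mfps_monom 1 (Inr v :: 'w::finite + 'v)) N = mfps_monomial (case_sum (\<lambda>_. 0) N)"
proof -
  have "(\<lambda>w :: 'w + 'v. \<Sum>v\<in>UNIV. if w = Inr v then N v else 0) = case_sum (\<lambda>_. 0) N"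
    by (auto simp: fun_eq_iff split: sum.splits)
  then show ?thesis by (simp add: mfps_prod_power_monom)
qed

lemma mfps_nth_subst_Inl:
  fixes f :: "('v::finite, 'a::rat_algebra_1) mfps" and L :: "'v + 'w::finite \<Rightarrow> nat"
  shows "mfps_nth (mfps_subst (\<lambda>v. mfps_monom 1 (Inl v)) f) L
    = (if L \<circ> Inr = (\<lambda>_. 0) then mfps_nth f (L \<circ> Inl) else 0)"
proof -
  have iff: "L = case_sum N (\<lambda>_. 0) \<longleftrightarrow> N = L \<circ> Inl \<and> L \<circ> Inr = (\<lambda>_. 0)" for N
    by (auto simp: fun_eq_iff split: sum.splits)
  have le: "total_degree (L \<circ> Inl) \<le> total_degree L"
  proof -
    have "total_degree (L \<circ> Inl) = sum L (range Inl)"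
      unfolding total_degree_def by (simp add: sum.reindex comp_def)
    also have "\<dots> \<le> total_degree L" unfolding total_degree_def by (rule sum_mono2) auto
    finally show ?thesis .
  qed
  have "mfps_nth (mfps_subst (\<lambda>v. mfps_monom 1 (Inl v)) f) L
      = (\<Sum>N | total_degree N \<le> total_degree L.
          if N = L \<circ> Inl then (if L \<circ> Inr = (\<lambda>_. 0) then mfps_nth f (L \<circ> Inl) else 0) else 0)"
    unfolding mfps_subst_def mfps_nth_Abs mfps_prod_power_Inl
    by (intro sum.cong refl) (auto simp: mfps_monomial_def iff scaleQ_one)
  then show ?thesis using le by (simp add: sum.delta finite_total_degree_le)
qed

lemma mfps_nth_subst_Inr:
  fixes f :: "('w::finite, 'a::rat_algebra_1) mfps" and L :: "'v::finite + 'w \<Rightarrow> nat"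
  shows "mfps_nth (mfps_subst (\<lambda>v. mfps_monom 1 (Inr v)) f) L
    = (if L \<circ> Inl = (\<lambda>_. 0) then mfps_nth f (L \<circ> Inr) else 0)"
proof -
  have iff: "L = case_sum (\<lambda>_. 0) N \<longleftrightarrow> N = L \<circ> Inr \<and> L \<circ> Inl = (\<lambda>_. 0)" for N
    by (auto simp: fun_eq_iff split: sum.splits)
  have le: "total_degree (L \<circ> Inr) \<le> total_degree L"
  proof -
    have "total_degree (L \<circ> Inr) = sum L (range Inr)"
      unfolding total_degree_def by (simp add: sum.reindex comp_def)
    also have "\<dots> \<le> total_degree L" unfolding total_degree_def by (rule sum_mono2) auto
    finally show ?thesis .
  qed
  have "mfps_nth (mfps_subst (\<lambda>v. mfps_monom 1 (Inr v)) f) L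
      = (\<Sum>N | total_degree N \<le> total_degree L.
          if N = L \<circ> Inr then (if L \<circ> Inl = (\<lambda>_. 0) then mfps_nth f (L \<circ> Inr) else 0) else 0)"
    unfolding mfps_subst_def mfps_nth_Abs mfps_prod_power_Inr
    by (intro sum.cong refl) (auto simp: mfps_monomial_def iff scaleQ_one)
  then show ?thesis using le by (simp add: sum.delta finite_total_degree_le)
qed

text \<open>
  A product of a series in the left variables with a series in the right variables has as
  coefficients all products of their coefficients.
\<close>

lemma mfps_nth_subst_Inl_Inr:
  fixes f :: "('v::finite, 'a::rat_algebra_1) mfps" and g :: "('w::finite, 'a) mfps"
  shows "mfps_nth (mfps_subst (\<lambda>v. mfps_monom 1 (Inl v)) f * mfps_subst (\<lambda>w. mfps_monom 1 (Inr w)) g)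
      (case_sum M N) = mfps_nth f M * mfps_nth g N"
proof -
  let ?L = "case_sum M N"
  have *: "A = case_sum M (\<lambda>_. 0)" if "A \<circ> Inr = (\<lambda>_. 0)" "(?L - A) \<circ> Inl = (\<lambda>_. 0)" "A \<le> ?L" for A
  proof
    fix x show "A x = case_sum M (\<lambda>_. 0) x"
    proof (cases x)
      case (Inl v)
      have "A (Inl v) \<le> M v" using le_funD[OF that(3), of "Inl v"] by simp
      moreover have "M v - A (Inl v) = 0" using fun_cong[OF that(2), of v] by simp
      ultimately show ?thesis by (simp add: Inl)
    next
      case (Inr w)
      then show ?thesis using fun_cong[OF that(1), of w] by simp
    qed
  qed
  have **: "?L - case_sum M (\<lambda>_. 0) = case_sum (\<lambda>_. 0) N"
    by (simp add: fun_eq_iff split: sum.splits)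
  have "mfps_nth (mfps_subst (\<lambda>v. mfps_monom 1 (Inl v)) f * mfps_subst (\<lambda>w. mfps_monom 1 (Inr w)) g) ?L
      = (\<Sum>A\<in>{..?L}. if A = case_sum M (\<lambda>_. 0) then mfps_nth f M * mfps_nth g N else 0)"
    unfolding mfps_nth_mult mfps_nth_subst_Inl mfps_nth_subst_Inr
  proof (intro sum.cong refl)
    fix A assume "A \<in> {..?L}"
    then have A: "A \<le> ?L" by simp
    show "(if A \<circ> Inr = (\<lambda>_. 0) then mfps_nth f (A \<circ> Inl) else 0) *
        (if (?L - A) \<circ> Inl = (\<lambda>_. 0) then mfps_nth g ((?L - A) \<circ> Inr) else 0)
      = (if A = case_sum M (\<lambda>_. 0) then mfps_nth f M * mfps_nth g N else 0)"
    proof (cases "A = case_sum M (\<lambda>_. 0)")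
      case True
      show ?thesis unfolding True ** by (simp add: comp_def)
    next
      case False
      then show ?thesis using *[OF _ _ A] by auto
    qed
  qed
  also have "\<dots> = mfps_nth f M * mfps_nth g N"
  proof -
    have "case_sum M (\<lambda>_. 0) x \<le> ?L x" for x by (cases x) auto
    then have "case_sum M (\<lambda>_. 0) \<le> ?L" by (rule le_funI)
    then show ?thesis by (simp add: sum.delta finite_atMost_fun_nat)
  qed
  finally show ?thesis .
qed

section \<open>The class sums as a basis of the centre\<close>

lemma lookup_single_mult:
  fixes z :: "'g::group_add \<Rightarrow>\<^sub>0 rat"
  shows "Poly_Mapping.lookup (Poly_Mapping.single h 1 * z) (h + x) = Poly_Mapping.lookup z x"
  by (induction z rule: poly_mapping_single_induct)
    (simp_all add: distrib_left lookup_add mult_single lookup_single when_def)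

lemma lookup_mult_single:
  fixes z :: "'g::group_add \<Rightarrow>\<^sub>0 rat"
  shows "Poly_Mapping.lookup (z * Poly_Mapping.single h 1) (x + h) = Poly_Mapping.lookup z x"
  by (induction z rule: poly_mapping_single_induct)
    (simp_all add: distrib_right lookup_add mult_single lookup_single when_def)

lemma lookup_central_conj:
  fixes z :: "'g::group_add \<Rightarrow>\<^sub>0 rat"
  assumes "\<And>a. z * a = a * z"
  shows "Poly_Mapping.lookup z (h + x - h) = Poly_Mapping.lookup z x"
proof -
  have "Poly_Mapping.lookup z (h + x - h)
      = Poly_Mapping.lookup (z * Poly_Mapping.single h 1) (h + x - h + h)"
    by (rule lookup_mult_single[symmetric])
  also have "\<dots> = Poly_Mapping.lookup (Poly_Mapping.single h 1 * z) (h + x)"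
    by (simp add: assms)
  also have "\<dots> = Poly_Mapping.lookup z x" by (rule lookup_single_mult)
  finally show ?thesis .
qed

lemma conj_class_eqI:
  assumes x: "x \<in> Rep_conj_class c" "x \<in> Rep_conj_class d"
  shows "c = d"
proof -
  have cls: "Rep_conj_class e = range (\<lambda>g. g + x - g)" if "x \<in> Rep_conj_class e" for e
  proof -
    obtain y where y: "Rep_conj_class e = range (\<lambda>g. g + y - g)"
      using Rep_conj_class[of e] by blast
    obtain h where h: "x = h + y - h" using \<open>x \<in> Rep_conj_class e\<close> y by blast
    have 1: "g + x - g = (g + h) + y - (g + h)" for g
      by (simp add: h diff_conv_add_uminus minus_add add.assoc del: add_uminus_conv_diff)
    have 2: "g + y - g = (g - h) + x - (g - h)" for g
      by (simp add: h diff_conv_add_uminus minus_add add.assoc del: add_uminus_conv_diff)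
    have "g + y - g \<in> range (\<lambda>g. g + x - g)" for g by (subst 2) (rule rangeI)
    moreover have "g + x - g \<in> range (\<lambda>g. g + y - g)" for g by (subst 1) (rule rangeI)
    ultimately show ?thesis unfolding y by (intro equalityI image_subsetI)
  qed
  then show ?thesis using x by (metis Rep_conj_class_inject)
qed

lemma conj_class_ex: "\<exists>c. x \<in> Rep_conj_class c"
proof -
  have "Rep_conj_class (Abs_conj_class (range (\<lambda>g. g + x - g))) = range (\<lambda>g. g + x - g)"
    by (rule Abs_conj_class_inverse) blast
  moreover have "x \<in> range (\<lambda>g. g + x - g)" by (rule range_eqI[of _ _ 0]) simp
  ultimately show ?thesis by metis
qed

definition class_rep :: "'g::group_add conj_class \<Rightarrow> 'g"
  where "class_rep c = (SOME x. x \<in> Rep_conj_class c)"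

lemma class_rep_in: "class_rep c \<in> Rep_conj_class c"
proof -
  obtain y where "Rep_conj_class c = range (\<lambda>g. g + y - g)"
    using Rep_conj_class[of c] by blast
  then have "0 + y - 0 \<in> Rep_conj_class c" by blast
  then show ?thesis unfolding class_rep_def by (rule someI)
qed

definition center_coeff :: "'g::group_add group_algebra_center \<Rightarrow> 'g conj_class \<Rightarrow> rat"
  where "center_coeff z c = Poly_Mapping.lookup (Rep_group_algebra_center z) (class_rep c)"

lemma center_coeff_add: "center_coeff (y + z) c = center_coeff y c + center_coeff z c"
  by (simp add: center_coeff_def plus_group_algebra_center.rep_eq lookup_add)

lemma lookup_scale_group_algebra:
  fixes z :: "'g::monoid_add \<Rightarrow>\<^sub>0 rat"
  shows "Poly_Mapping.lookup (Poly_Mapping.single 0 q * z) g = q * Poly_Mapping.lookup z g"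
  by (induction z rule: poly_mapping_single_induct)
    (simp_all add: distrib_left lookup_add mult_single lookup_single when_def)

lemma center_coeff_scaleQ: "center_coeff (q *\<^sub>Q z) c = q * center_coeff z c"
  by (simp add: center_coeff_def scaleQ_group_algebra_center.rep_eq lookup_scale_group_algebra)

lemma lookup_class_sum:
  "Poly_Mapping.lookup (Rep_group_algebra_center (class_sum c)) g
    = (if g \<in> Rep_conj_class c then 1 else 0)"
  by (simp add: class_sum.rep_eq lookup_sum lookup_single when_def)

lemma center_coeff_class_sum: "center_coeff (class_sum c) d = (if c = d then 1 else 0)"
  using conj_class_eqI[OF class_rep_in, of d c] class_rep_in[of d]
  by (auto simp: center_coeff_def lookup_class_sum)

lemma Rep_group_algebra_center_sum:
  "Rep_group_algebra_center (\<Sum>i\<in>S. f i) = (\<Sum>i\<in>S. Rep_group_algebra_center (f i))"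
  by (induction S rule: infinite_finite_induct)
    (simp_all add: zero_group_algebra_center.rep_eq plus_group_algebra_center.rep_eq)

text \<open>
  The coefficients of a central element are constant on conjugacy classes.
\<close>

lemma center_expand:
  fixes z :: "'g::{group_add,finite} group_algebra_center"
  shows "z = (\<Sum>c\<in>UNIV. center_coeff z c *\<^sub>Q class_sum c)"
proof -
  have "Rep_group_algebra_center z = Rep_group_algebra_center (\<Sum>c\<in>UNIV. center_coeff z c *\<^sub>Q class_sum c)"
  proof (rule poly_mapping_eqI)
    fix g :: 'g
    obtain c where c: "g \<in> Rep_conj_class c" using conj_class_ex by blast
    obtain y where y: "Rep_conj_class c = range (\<lambda>h. h + y - h)"
      using Rep_conj_class[of c] by blast
    have conj: "Poly_Mapping.lookup (Rep_group_algebra_center z) (h + x - h)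
        = Poly_Mapping.lookup (Rep_group_algebra_center z) x" for h x
      using Rep_group_algebra_center[of z] by (intro lookup_central_conj) auto
    have const: "Poly_Mapping.lookup (Rep_group_algebra_center z) x
        = Poly_Mapping.lookup (Rep_group_algebra_center z) y" if "x \<in> Rep_conj_class c" for x
    proof -
      obtain h where "x = h + y - h" using \<open>x \<in> Rep_conj_class c\<close> y by blast
      then show ?thesis by (simp only: conj)
    qed
    have g_iff: "g \<in> Rep_conj_class d \<longleftrightarrow> d = c" for d
      using conj_class_eqI[OF c, of d] c by blast
    have "Poly_Mapping.lookup (Rep_group_algebra_center (\<Sum>c\<in>UNIV. center_coeff z c *\<^sub>Q class_sum c)) g
        = (\<Sum>d\<in>UNIV. if d = c then center_coeff z c else 0)"
      unfolding Rep_group_algebra_center_sum lookup_sum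
      by (intro sum.cong refl)
        (simp add: scaleQ_group_algebra_center.rep_eq lookup_scale_group_algebra lookup_class_sum g_iff)
    also have "\<dots> = Poly_Mapping.lookup (Rep_group_algebra_center z) g"
      using const[OF c] const[OF class_rep_in] by (simp add: center_coeff_def)
    finally show "Poly_Mapping.lookup (Rep_group_algebra_center z) g
      = Poly_Mapping.lookup (Rep_group_algebra_center (\<Sum>c\<in>UNIV. center_coeff z c *\<^sub>Q class_sum c)) g"
      by simp
  qed
  then show ?thesis by (simp add: Rep_group_algebra_center_inject)
qed

lemma center_coeff_mult_in_Ints: "center_coeff (class_sum a * class_sum b) c \<in> \<int>"
  unfolding center_coeff_def times_group_algebra_center.rep_eq class_sum.rep_eq sum_product lookup_sum
  by (intro Ints_sum) (simp add: mult_single lookup_single when_def)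

text \<open>
  The structure constants are integers because the coefficients of a product of class sums count
  factorisations in the group.
\<close>

lemma class_sum_mult:
  obtains n :: "'g::{group_add,finite} conj_class \<Rightarrow> 'g conj_class \<Rightarrow> 'g conj_class \<Rightarrow> int"
  where "\<And>a b. class_sum a * class_sum b = (\<Sum>c\<in>UNIV. of_int (n a b c) *\<^sub>Q class_sum c)"
proof
  fix a b :: "'g conj_class"
  show "class_sum a * class_sum b
      = (\<Sum>c\<in>UNIV. of_int \<lfloor>center_coeff (class_sum a * class_sum b) c\<rfloor> *\<^sub>Q class_sum c)"
    using center_expand[of "class_sum a * class_sum b"]
    by (simp add: center_coeff_mult_in_Ints)
qed

section \<open>The span of the coefficients is a ring\<close>

definition generic_sum :: "('g::{group_add,finite} conj_class, 'g group_algebra_center) mfps"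
  where "generic_sum = (\<Sum>c\<in>UNIV. mfps_monom (class_sum c) c)"

lemma no_constant_term_generic_sum: "no_constant_term generic_sum"
  unfolding generic_sum_def by (intro no_constant_term_sum no_constant_term_monom)

lemma B_coeff_conv_exp_T_log: "B_coeff = mfps_nth (exp_T_log generic_sum)"
  by (simp add: B_coeff_def exp_T_log_def generic_sum_def)

lemma R_setI: "finite S \<Longrightarrow> (\<Sum>N\<in>S. of_int (k N) * B_coeff N) \<in> R_set"
  unfolding R_set_def by blast

lemma R_setE:
  assumes "r \<in> R_set"
  obtains S k where "finite S" "r = (\<Sum>N\<in>S. of_int (k N) * B_coeff N)"
  using assms unfolding R_set_def by blast

lemma R_set_add:
  assumes "r \<in> R_set" "s \<in> R_set"
  shows "r + s \<in> R_set"
proof -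
  obtain S k where S: "finite S" "r = (\<Sum>N\<in>S. of_int (k N) * B_coeff N)"
    using assms(1) by (rule R_setE)
  obtain S' k' where S': "finite S'" "s = (\<Sum>N\<in>S'. of_int (k' N) * B_coeff N)"
    using assms(2) by (rule R_setE)
  define l where "l N = (if N \<in> S then k N else 0)" for N
  define l' where "l' N = (if N \<in> S' then k' N else 0)" for N
  have "r = (\<Sum>N\<in>S \<union> S'. of_int (l N) * B_coeff N)"
    unfolding S(2) by (rule sum.mono_neutral_cong_left) (auto simp: S(1) S'(1) l_def)
  moreover have "s = (\<Sum>N\<in>S \<union> S'. of_int (l' N) * B_coeff N)"
    unfolding S'(2) by (rule sum.mono_neutral_cong_left) (auto simp: S(1) S'(1) l'_def)
  ultimately have "r + s = (\<Sum>N\<in>S \<union> S'. of_int (l N + l' N) * B_coeff N)"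
    by (simp add: distrib_right sum.distrib)
  also have "\<dots> \<in> R_set" by (rule R_setI) (simp add: S(1) S'(1))
  finally show ?thesis .
qed

lemma R_set_zero: "0 \<in> R_set"
  using R_setI[of "{}"] by simp

lemma R_set_sum: "(\<And>i. i \<in> S \<Longrightarrow> f i \<in> R_set) \<Longrightarrow> (\<Sum>i\<in>S. f i) \<in> R_set"
  by (induction S rule: infinite_finite_induct) (auto intro: R_set_add R_set_zero)

lemma R_set_of_int_mult:
  assumes "r \<in> R_set"
  shows "of_int m * r \<in> R_set"
proof -
  obtain S k where S: "finite S" "r = (\<Sum>N\<in>S. of_int (k N) * B_coeff N)"
    using assms by (rule R_setE)
  have "of_int m * r = (\<Sum>N\<in>S. of_int (m * k N) * B_coeff N)"
    by (simp add: S(2) sum_distrib_left mult.assoc)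
  also have "\<dots> \<in> R_set" by (rule R_setI[OF S(1)])
  finally show ?thesis .
qed

lemma B_coeff_in_R_set: "B_coeff N \<in> R_set"
  using R_setI[of "{N}" "\<lambda>_. 1"] by simp

text \<open>
  Let \<open>E(x)\<close> be the generating series of the \<open>B_coeff N\<close>. As \<open>exp_T_log\<close> is multiplicative,
  \<open>E(x) E(y) = E(z)\<close> where \<open>(1 + \<Sum>\<^sub>c c x\<^sub>c) (1 + \<Sum>\<^sub>c c y\<^sub>c) = 1 + \<Sum>\<^sub>c c z\<^sub>c\<close>. The \<open>z\<^sub>c\<close> are polynomials
  in the \<open>x\<close> and \<open>y\<close> with integer coefficients, so the coefficient at \<open>x\<^bsup>M\<^esup> y\<^bsup>N\<^esup>\<close> of the right-hand side is
  an integral combination of coefficients of \<open>E\<close>, whereas on the left it is the product.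
\<close>

lemma B_coeff_mult_in_R_set:
  fixes M N :: "'g::{group_add,finite} conj_class \<Rightarrow> nat"
  shows "B_coeff M * B_coeff N \<in> R_set"
proof -
  let ?s = "class_sum :: 'g conj_class \<Rightarrow> 'g group_algebra_center"
  obtain n where n: "\<And>a b. ?s a * ?s b = (\<Sum>c\<in>UNIV. of_int (n a b c) *\<^sub>Q ?s c)"
    by (rule class_sum_mult) blast
  define x :: "'g conj_class \<Rightarrow> ('g conj_class + 'g conj_class, int) mfps"
    where "x = (\<lambda>c. mfps_monom 1 (Inl c))"
  define y :: "'g conj_class \<Rightarrow> ('g conj_class + 'g conj_class, int) mfps"
    where "y = (\<lambda>c. mfps_monom 1 (Inr c))"
  define z where "z c = (x c + y c) + structure_mult n x y c" for c
  have x: "no_constant_term (x c)" and y: "no_constant_term (y c)" for c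
    by (simp_all add: x_def y_def no_constant_term_monom)
  have z: "no_constant_term (z c)" for c
    unfolding z_def by (intro no_constant_term_add no_constant_term_structure_mult x y)
  have E: "mfps_subst w (exp_T_log generic_sum) = exp_T_log (lincomb ?s w)"
    if "\<And>c. no_constant_term (w c)" for w :: "'g conj_class \<Rightarrow> ('g conj_class + 'g conj_class, int) mfps"
    using that
    by (simp add: mfps_subst_exp_T_log no_constant_term_generic_sum)
      (simp add: generic_sum_def mfps_subst_generic)
  have "lincomb ?s z = lincomb ?s x + lincomb ?s y + lincomb ?s x * lincomb ?s y"
    unfolding lincomb_mult[OF n] z_def lincomb_add ..
  then have "1 + lincomb ?s z = (1 + lincomb ?s x) * (1 + lincomb ?s y)"
    by (simp add: algebra_simps)
  then have "exp_T_log (lincomb ?s z) = exp_T_log (lincomb ?s x) * exp_T_log (lincomb ?s y)"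
    by (intro exp_T_log_mult no_constant_term_lincomb x y)
  then have "mfps_subst x (exp_T_log generic_sum) * mfps_subst y (exp_T_log generic_sum)
      = mfps_subst z (exp_T_log generic_sum)"
    by (simp add: E x y z)
  then have "B_coeff M * B_coeff N
      = mfps_nth (mfps_subst z (exp_T_log generic_sum)) (case_sum M N)"
    using mfps_nth_subst_Inl_Inr[of "exp_T_log generic_sum" "exp_T_log generic_sum" M N]
    by (simp add: B_coeff_conv_exp_T_log x_def y_def)
  also have "\<dots> \<in> R_set"
    unfolding mfps_subst_def mfps_nth_Abs B_coeff_conv_exp_T_log[symmetric] scaleQ_of_int
    by (intro R_set_sum R_set_of_int_mult B_coeff_in_R_set)
  finally show ?thesis .
qed

lemma R_set_mult:
  assumes "r \<in> R_set" "s \<in> R_set"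
  shows "r * s \<in> R_set"
proof -
  obtain S k where S: "r = (\<Sum>N\<in>S. of_int (k N) * B_coeff N)"
    using assms(1) by (rule R_setE)
  obtain S' k' where S': "s = (\<Sum>N\<in>S'. of_int (k' N) * B_coeff N)"
    using assms(2) by (rule R_setE)
  have "r * s = (\<Sum>M\<in>S. \<Sum>N\<in>S'. of_int (k M) * (of_int (k' N) * (B_coeff M * B_coeff N)))"
    unfolding S S' sum_product by (intro sum.cong refl) (simp only: mult_ac)
  also have "\<dots> \<in> R_set"
    by (intro R_set_sum R_set_of_int_mult B_coeff_mult_in_R_set)
  finally show ?thesis .
qed

lemma R_set_one: "1 \<in> R_set"
proof -
  have "B_coeff (\<lambda>_. 0) = 1"
    unfolding B_coeff_conv_exp_T_log exp_T_log_def
    by (intro mfps_nth_exp_zero no_constant_term_T_log no_constant_term_generic_sum)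
  then show ?thesis using B_coeff_in_R_set by metis
qed

lemma mfps_nth_exp_T_log_linear:
  fixes f :: "('v::finite, 'a::{rat_algebra_1,comm_ring_1}) mfps"
  assumes f: "no_constant_term f" and N: "total_degree N = 1"
  shows "mfps_nth (exp_T_log f) N = uea_gen (mfps_nth f N)"
proof -
  have N0: "N \<noteq> (\<lambda>_. 0)" using N by auto
  have "mfps_nth (mfps_log (1 + f)) N = mfps_nth f N"
    using N by (simp add: mfps_log_conv_power_series[OF f] mfps_power_series_def log_coeff_def scaleQ_one)
  then show ?thesis
    using N N0 mfps_exp_conv_power_series[OF no_constant_term_T_log[OF f]]
    by (simp add: exp_T_log_def mfps_power_series_def exp_coeff_def scaleQ_one mfps_nth_one T_series_def)
qed

lemma uea_gen_class_sum_in_R_set: "uea_gen (class_sum c) \<in> R_set"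
proof -
  let ?e = "\<lambda>w. if w = c then 1 else (0::nat)"
  have "?e = (\<lambda>w. if w = d then 1 else 0) \<longleftrightarrow> d = c" for d
    by (auto simp: fun_eq_iff split: if_splits)
  then have "mfps_nth generic_sum ?e = class_sum c"
    by (simp add: generic_sum_def mfps_nth_monom)
  then have "B_coeff ?e = uea_gen (class_sum c)"
    using mfps_nth_exp_T_log_linear[OF no_constant_term_generic_sum, of ?e]
    by (simp add: B_coeff_conv_exp_T_log total_degree_def)
  then show ?thesis using B_coeff_in_R_set by metis
qed

section \<open>Denominators\<close>

inductive_set T_subring :: "'g::{group_add,finite} group_algebra_center uea set" where
  one: "1 \<in> T_subring"
| gen: "u \<in> T_subring \<Longrightarrow> uea_gen (class_sum c) * u \<in> T_subring"
| add: "u \<in> T_subring \<Longrightarrow> v \<in> T_subring \<Longrightarrow> u + v \<in> T_subring"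
| minus: "u \<in> T_subring \<Longrightarrow> - u \<in> T_subring"

lemma T_subring_subset: "T_subring \<subseteq> R_set"
proof
  fix u :: "'a group_algebra_center uea"
  assume "u \<in> T_subring"
  then show "u \<in> R_set"
  proof induction
    case (minus u)
    then show ?case using R_set_of_int_mult[of u "- 1"] by simp
  qed (auto intro: R_set_one R_set_mult uea_gen_class_sum_in_R_set R_set_add)
qed

lemma T_subring_of_int_mult: "u \<in> T_subring \<Longrightarrow> of_int k * u \<in> T_subring"
proof -
  assume u: "u \<in> T_subring"
  have "0 \<in> T_subring"
    using T_subring.add[OF T_subring.one T_subring.minus[OF T_subring.one]] by simp
  then have nat: "of_nat n * u \<in> T_subring" for n
    by (induction n) (auto simp: distrib_right u intro: T_subring.add)
  show ?thesis
    by (cases k rule: int_cases2) (use nat T_subring.minus in auto)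
qed

text \<open>
  The class sums form a basis over \<open>\<rat>\<close>, so the enveloping algebra is the \<open>\<rat>\<close>-algebra generated by
  them; it is obtained from the subring that they generate by inverting positive integers.
\<close>

lemma uea_denominator:
  fixes u :: "'g::{group_add,finite} group_algebra_center uea"
  shows "\<exists>m>0. of_nat m * u \<in> T_subring"
proof -
  define W :: "'g group_algebra_center uea set" where "W = {u. \<exists>m>0. of_nat m * u \<in> T_subring}"
  have W_scale: "q *\<^sub>Q u \<in> W" if u: "u \<in> W" for q u
  proof -
    obtain m where m: "m > 0" "of_nat m * u \<in> T_subring" using u by (auto simp: W_def)
    obtain a b where ab: "quotient_of q = (a, b)" by fastforce
    have b: "b > 0" using quotient_of_denom_pos[OF ab] .
    have q: "q = of_int a / of_int b" using quotient_of_div[OF ab] .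
    have "of_nat (nat b * m) *\<^sub>Q q *\<^sub>Q u = of_int a *\<^sub>Q of_nat m *\<^sub>Q u"
      using b by (simp add: scaleQ_scaleQ q mult.commute)
    also have "\<dots> = of_int a * (of_nat m * u)" by (simp add: scaleQ_of_int scaleQ_of_nat)
    also have "\<dots> \<in> T_subring" by (rule T_subring_of_int_mult[OF m(2)])
    finally have "of_nat (nat b * m) * (q *\<^sub>Q u) \<in> T_subring" by (simp only: scaleQ_of_nat)
    moreover have "nat b * m > 0" using b m(1) by simp
    ultimately show ?thesis unfolding W_def by blast
  qed
  have W_add: "u + v \<in> W" if uv: "u \<in> W" "v \<in> W" for u v
  proof -
    obtain m n where m: "m > 0" "of_nat m * u \<in> T_subring" and n: "n > 0" "of_nat n * v \<in> T_subring"
      using uv by (auto simp: W_def)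
    have "of_nat (m * n) * (u + v) = of_int (int n) * (of_nat m * u) + of_int (int m) * (of_nat n * v)"
      by (simp add: algebra_simps)
    also have "\<dots> \<in> T_subring" by (intro T_subring.add T_subring_of_int_mult m n)
    finally show ?thesis unfolding W_def using m n by (auto intro!: exI[of _ "m * n"])
  qed
  have W_gen: "uea_gen (class_sum c) * u \<in> W" if u: "u \<in> W" for c u
  proof -
    obtain m where m: "m > 0" "of_nat m * u \<in> T_subring" using u by (auto simp: W_def)
    have "of_nat m * (uea_gen (class_sum c) * u) = uea_gen (class_sum c) * (of_nat m * u)"
      by (simp only: mult_ac)
    also have "\<dots> \<in> T_subring" by (rule T_subring.gen[OF m(2)])
    finally show ?thesis using m(1) by (auto simp: W_def)
  qed
  have W_one: "1 \<in> W" using T_subring.one by (auto simp: W_def intro!: exI[of _ 1])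
  have W_sum: "(\<Sum>i\<in>S. f i) \<in> W" if "\<And>i. i \<in> S \<Longrightarrow> f i \<in> W" for S :: "'g conj_class set" and f
    using that W_scale[OF W_one, of 0]
    by (induction S rule: infinite_finite_induct) (auto intro: W_add)
  have "u \<in> W"
  proof (induction u rule: uea_induct)
    case (gen a u)
    have "uea_gen a * u = (\<Sum>c\<in>UNIV. center_coeff a c *\<^sub>Q (uea_gen (class_sum c) * u))"
      by (subst center_expand[of a])
        (simp add: uea_gen_sum uea_gen_scaleQ sum_distrib_right mult_scaleQ_left)
    also have "\<dots> \<in> W" by (intro W_sum W_scale W_gen gen)
    finally show ?case .
  qed (auto intro: W_one W_add W_scale)
  then show ?thesis by (simp add: W_def)
qed

section \<open>Ring homomorphisms into a field\<close>

lemma ring_hom_R_ring_iff: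
  "\<phi> \<in> ring_hom R_ring (ring_of_type_algebra :: 'f::comm_ring_1 ring) \<longleftrightarrow>
    \<phi> 1 = 1 \<and> (\<forall>u\<in>R_set. \<forall>v\<in>R_set. \<phi> (u + v) = \<phi> u + \<phi> v \<and> \<phi> (u * v) = \<phi> u * \<phi> v)"
  by (auto simp: ring_hom_def R_ring_def ring_of_type_algebra_def)

text \<open>
  On the subring generated by the class sums the two maps agree, and every element of the larger
  ring has a positive multiple in there, which determines its value in characteristic zero.
\<close>

lemma ring_hom_R_ring_eqI:
  fixes \<phi> \<psi> :: "'g::{group_add,finite} group_algebra_center uea \<Rightarrow> 'f::field_char_0"
  assumes \<phi>: "\<phi> \<in> ring_hom R_ring ring_of_type_algebra"
    and \<psi>: "\<psi> \<in> ring_hom R_ring ring_of_type_algebra"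
    and eq: "\<And>c. \<phi> (uea_gen (class_sum c)) = \<psi> (uea_gen (class_sum c))"
    and r: "r \<in> R_set"
  shows "\<phi> r = \<psi> r"
proof -
  have add: "h (u + v) = h u + h v" and mult: "h (u * v) = h u * h v" and h_one: "h 1 = 1"
    if "h \<in> {\<phi>, \<psi>}" "u \<in> R_set" "v \<in> R_set" for h u v
    using that \<phi> \<psi> by (auto simp: ring_hom_R_ring_iff)
  have zero: "h 0 = 0" if "h \<in> {\<phi>, \<psi>}" for h
    using add[OF that R_set_zero R_set_zero] by simp
  have uminus: "h (- u) = - h u" if h: "h \<in> {\<phi>, \<psi>}" and u: "u \<in> R_set" for h u
    using add[OF h u, of "- u"] R_set_of_int_mult[OF u, of "- 1"] zero[OF h]
    by (simp add: eq_neg_iff_add_eq_0 add.commute)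
  have T: "\<phi> u = \<psi> u" if "u \<in> T_subring" for u
    using that
  proof induction
    case one
    show ?case using h_one[of \<phi>, OF _ R_set_one R_set_one] h_one[of \<psi>, OF _ R_set_one R_set_one] by simp
  next
    case (gen u c)
    then have "u \<in> R_set" using T_subring_subset by blast
    then show ?case using gen eq mult uea_gen_class_sum_in_R_set by (metis insertCI)
  next
    case (add u v)
    then have "u \<in> R_set" "v \<in> R_set" using T_subring_subset by blast+
    then show ?case using add assms(1,2) by (simp add: ring_hom_R_ring_iff)
  next
    case (minus u)
    then have "u \<in> R_set" using T_subring_subset by blast
    then show ?case using minus uminus by (metis insertCI)
  qed
  have nat: "h (of_nat m * r) = of_nat m * h r" if h: "h \<in> {\<phi>, \<psi>}" for h m
  proof (induction m)
    case (Suc m)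
    have "of_nat m * r \<in> R_set" using R_set_of_int_mult[OF r, of "int m"] by simp
    then show ?case using add[OF h r, of "of_nat m * r"] Suc by (simp add: distrib_right)
  qed (simp add: zero[OF h])
  obtain m where m: "m > 0" "of_nat m * r \<in> T_subring" using uea_denominator by blast
  have "of_nat m * \<phi> r = of_nat m * \<psi> r" using T[OF m(2)] nat by simp
  then show ?thesis using m(1) by simp
qed

text \<open>
  The linear functional on the centre with value \<open>a c\<close> at the class sum of \<open>c\<close> extends to the whole
  enveloping algebra.
\<close>

lemma ex_ring_hom_R_ring:
  fixes a :: "'g::{group_add,finite} conj_class \<Rightarrow> 'f::field_char_0"
  obtains \<phi> where "\<phi> \<in> ring_hom R_ring (ring_of_type_algebra :: 'f ring)"
    "\<And>c. \<phi> (uea_gen (class_sum c)) = a c"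
proof -
  define l where "l z = (\<Sum>c\<in>UNIV. of_rat (center_coeff z c) * a c)" for z
  have l_add: "l (y + z) = l y + l z" for y z
    by (simp add: l_def center_coeff_add of_rat_add distrib_right sum.distrib)
  have l_scale: "l (q *\<^sub>Q z) = of_rat q * l z" for q z
    by (simp add: l_def center_coeff_scaleQ of_rat_mult sum_distrib_left mult.assoc)
  obtain \<phi> where \<phi>: "\<phi> 1 = 1" "\<And>u v. \<phi> (u + v) = \<phi> u + \<phi> v" "\<And>u v. \<phi> (u * v) = \<phi> u * \<phi> v"
    "\<And>x. \<phi> (uea_gen x) = l x"
    using uea_universal[of l, OF l_add l_scale] by blast
  have "l (class_sum c) = a c" for c
  proof -
    have "l (class_sum c) = (\<Sum>d\<in>UNIV. if d = c then a c else 0)"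
      unfolding l_def by (intro sum.cong) (auto simp: center_coeff_class_sum)
    then show ?thesis by simp
  qed
  with \<phi> show thesis by (intro that[of \<phi>]) (simp_all add: ring_hom_R_ring_iff)
qed

theorem propositionA8:
  shows "bij_betw
    (\<lambda>\<phi> c. \<phi> (uea_gen (class_sum c)))
    (ring_hom (R_ring :: 'g::{group_add,finite} group_algebra_center uea ring)
        (ring_of_type_algebra :: 'f::field_char_0 ring)
      \<inter> extensional (carrier (R_ring :: 'g group_algebra_center uea ring)))
    (UNIV :: ('g conj_class \<Rightarrow> 'f) set)"
  (is "bij_betw ?ev (?H \<inter> ?E) UNIV")
proof (rule bij_betw_imageI)
  have carrier: "carrier (R_ring :: 'g group_algebra_center uea ring) = R_set"
    by (simp add: R_ring_def)
  show "inj_on ?ev (?H \<inter> ?E)"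
  proof (rule inj_onI)
    fix \<phi> \<psi> assume \<phi>: "\<phi> \<in> ?H \<inter> ?E" and \<psi>: "\<psi> \<in> ?H \<inter> ?E" and "?ev \<phi> = ?ev \<psi>"
    then have "\<phi> (uea_gen (class_sum c)) = \<psi> (uea_gen (class_sum c))" for c
      by (simp add: fun_eq_iff)
    then have "\<phi> r = \<psi> r" if "r \<in> R_set" for r
      using ring_hom_R_ring_eqI that \<phi> \<psi> by blast
    then show "\<phi> = \<psi>" using \<phi> \<psi> carrier by (intro extensionalityI[of \<phi> R_set]) auto
  qed
  have "a \<in> ?ev ` (?H \<inter> ?E)" for a
  proof -
    obtain \<phi> where \<phi>: "\<phi> \<in> ?H" "\<And>c. \<phi> (uea_gen (class_sum c)) = a c"
      using ex_ring_hom_R_ring[of a] by blast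
    have "restrict \<phi> R_set \<in> ?H"
      using \<phi>(1) by (simp add: ring_hom_R_ring_iff R_set_one R_set_add R_set_mult)
    moreover have "?ev (restrict \<phi> R_set) = a"
      by (simp add: fun_eq_iff \<phi>(2) uea_gen_class_sum_in_R_set)
    ultimately show ?thesis by (intro image_eqI[of _ _ "restrict \<phi> R_set"]) (simp_all add: carrier)
  qed
  then show "?ev ` (?H \<inter> ?E) = UNIV" by blast
qed

end
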